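(* Let $r=1$ and $0<\alpha\le1$. Let $\Delta>0$ be a constant such that $\Delta_1\le\Delta$, and let $k^*$ be the largest index $k\in\{1,\dots,K\}$ with $\Delta_k\le\Delta$. Suppose the critical values $\mathfrak z_1,\dots,\mathfrak z_{K-1}$ satisfy the propagation condition (with $r=1$) $$\mathbf{E}_0\bigl|v_k^{-1}(\widehat\theta_k-\widetilde\theta_k)^2\bigr|\le\alpha\,\mathfrak c_1,\qquad k=2,\dots,K,$$ where $\mathfrak c_1=1$. Then $$v_{k^*}^{-1/2}\,\mathbf{E}|\widehat\theta-\theta|\le 2\sqrt{e^{\Delta}}+\sqrt{2\mathfrak z_{k^*}}.$$
   Context: Setting. Let $\widetilde\theta_k=\theta_k+\xi_k$, $k=1,\dots,K$, where $\theta_1,\dots,\theta_K$ are real numbers and $(\xi_1,\dots,\xi_K)$ is a zero-mean Gaussian vector with known invertible covariance matrix $B$. Put $v_k=\operatorname{Var}(\widetilde\theta_k)=\mathbf{E}\xi_k^2>0$; the $v_k$ decrease with $k$. $\mathbf{E}$ is expectation under this model. $\mathbf{E}_0$ is expectation when $\theta_1=\dots=\theta_K=0$ with the same covariance matrix $B$. For $r>0$, $\mathfrak c_r=\mathbf{E}|\xi|^{2r}$ for $\xi$ standard normal. Procedure. Given critical values $\mathfrak z_1,\dots,\mathfrak z_{K-1}\in[0,\infty]$, let $T_{lk}=v_l^{-1}(\widetilde\theta_l-\widetilde\theta_k)^2/2$ for $l<k$, $$\widehat k=\max\{k\le K:\ T_{lm}\le\mathfrak z_l\ \text{ for all } l<m\le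 k\},$$ $\widehat\theta=\widetilde\theta_{\widehat k}$ and $\widehat\theta_k=\widetilde\theta_{\min\{\widehat k,k\}}$. The value $\mathfrak z_K$, not used by the procedure, is an arbitrary nonnegative number. Modeling bias. Let $\theta\in\mathbb R$ be the target value, $b_k=\theta_k-\theta$, $b(k)=(b_1,\dots,b_k)^\top$, $B_k$ the covariance matrix of $(\widetilde\theta_1,\dots,\widetilde\theta_k)^\top$, and $\Delta_k=b(k)^\top B_k^{-1}b(k)$. *)

theory Defs
  imports "HOL-Probability.Probability" "Jordan_Normal_Form.Gauss_Jordan_Elimination"
begin

text \<open>Point masses count as Gaussian, so that every linear combination of the components of a
  Gaussian vector is Gaussian even when some combination vanishes (e.g. with zero coefficients).\<close>

definition gaussian_rv :: "'a measure \<Rightarrow> ('a \<Rightarrow> real) \<Rightarrow> bool" where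
  "gaussian_rv M Y \<longleftrightarrow>
     (\<exists>\<mu> \<sigma>. 0 < \<sigma> \<and> distributed M lborel Y (\<lambda>x. ennreal (normal_density \<mu> \<sigma> x))) \<or>
     (\<exists>\<mu>. Y \<in> borel_measurable M \<and> (AE \<omega> in M. Y \<omega> = \<mu>))"

definition gaussian_vector :: "'a measure \<Rightarrow> nat \<Rightarrow> (nat \<Rightarrow> 'a \<Rightarrow> real) \<Rightarrow> bool" where
  "gaussian_vector M K X \<longleftrightarrow>
     (\<forall>c :: nat \<Rightarrow> real. gaussian_rv M (\<lambda>\<omega>. \<Sum>k = 1..K. c k * X k \<omega>))"

definition covariance :: "'a measure \<Rightarrow> ('a \<Rightarrow> real) \<Rightarrow> ('a \<Rightarrow> real) \<Rightarrow> real" where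
  "covariance M X Y =
     (\<integral>\<omega>. (X \<omega> - (\<integral>\<eta>. X \<eta> \<partial>M)) * (Y \<omega> - (\<integral>\<eta>. Y \<eta> \<partial>M)) \<partial>M)"

text \<open>The components of a random vector are numbered from 1, but rows, columns and vector
  entries of \<^typ>\<open>real mat\<close> and \<^typ>\<open>real vec\<close> from 0; hence the shifts by \<^const>\<open>Suc\<close>.\<close>

definition covariance_mat :: "'a measure \<Rightarrow> nat \<Rightarrow> (nat \<Rightarrow> 'a \<Rightarrow> real) \<Rightarrow> real mat" where
  "covariance_mat M k X = mat k k (\<lambda>(i, j). covariance M (X (Suc i)) (X (Suc j)))"

definition bias_vec :: "(nat \<Rightarrow> real) \<Rightarrow> real \<Rightarrow> nat \<Rightarrow> real vec" where
  "bias_vec \<theta> t k = vec k (\<lambda>i. \<theta> (Suc i) - t)"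

text \<open>The quadratic form \<open>b(k)\<^sup>T B\<^sub>k\<^sup>-\<^sup>1 b(k)\<close>, where \<open>X\<close> are the estimates, \<open>\<theta>\<close> their means and
  \<open>t\<close> is the target. Meaningful only if the covariance matrix of \<open>(X 1, \<dots>, X k)\<close> is invertible.\<close>

definition modeling_bias ::
    "'a measure \<Rightarrow> (nat \<Rightarrow> 'a \<Rightarrow> real) \<Rightarrow> (nat \<Rightarrow> real) \<Rightarrow> real \<Rightarrow> nat \<Rightarrow> real" where
  "modeling_bias M X \<theta> t k =
     bias_vec \<theta> t k \<bullet> (the (mat_inverse (covariance_mat M k X)) *\<^sub>v bias_vec \<theta> t k)"

definition abs_normal_moment :: "real \<Rightarrow> real" where
  "abs_normal_moment r = (\<integral>x. std_normal_density x * \<bar>x\<bar> powr (2 * r) \<partial>lborel)"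

text \<open>The procedure as a deterministic function of the realized estimates \<open>x 1, \<dots>, x K\<close>. The
  critical values are of type \<^typ>\<open>ennreal\<close> because the value infinity is allowed.\<close>

definition test_stat :: "(nat \<Rightarrow> real) \<Rightarrow> (nat \<Rightarrow> real) \<Rightarrow> nat \<Rightarrow> nat \<Rightarrow> real" where
  "test_stat v x l k = inverse (v l) * (x l - x k)\<^sup>2 / 2"

definition selected ::
    "nat \<Rightarrow> (nat \<Rightarrow> real) \<Rightarrow> (nat \<Rightarrow> ennreal) \<Rightarrow> (nat \<Rightarrow> real) \<Rightarrow> nat" where
  "selected K v z x =
     Max {k \<in> {1..K}. \<forall>l m. 1 \<le> l \<and> l < m \<and> m \<le> k \<longrightarrow> ennreal (test_stat v x l m) \<le> z l}"

definition adaptive_estimate ::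
    "nat \<Rightarrow> (nat \<Rightarrow> real) \<Rightarrow> (nat \<Rightarrow> ennreal) \<Rightarrow> (nat \<Rightarrow> real) \<Rightarrow> real" where
  "adaptive_estimate K v z x = x (selected K v z x)"

definition stepwise_estimate ::
    "nat \<Rightarrow> (nat \<Rightarrow> real) \<Rightarrow> (nat \<Rightarrow> ennreal) \<Rightarrow> nat \<Rightarrow> (nat \<Rightarrow> real) \<Rightarrow> real" where
  "stepwise_estimate K v z k x = x (min (selected K v z x) k)"

definition ennreal_sqrt :: "ennreal \<Rightarrow> ennreal" where
  "ennreal_sqrt a = (if a = \<infinity> then \<infinity> else ennreal (sqrt (enn2real a)))"

end

theory Submission
  imports Defs "Jordan_Normal_Form.Determinant"
begin

text \<open>With \<open>m = k\<^sup>*\<close> and \<open>p\<close> the selected index, either \<open>p \<le> m\<close> and the adaptive and the stepwise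
  estimate agree, or the accepted test \<open>T m p\<close> bounds their difference by \<open>sqrt (2 v m * z m)\<close>. The
  remaining errors depend only on the first \<open>m\<close> coordinates and do not change when estimates and target
  are shifted together, so they are evaluated at the noise \<open>\<xi>\<close> shifted by the bias \<open>b\<close>. By
  Cameron-Martin, this shift multiplies the law by a density whose second moment is \<open>exp \<Delta>\<close>, and
  Cauchy-Schwarz reduces the claim to second moments without bias: \<open>v m\<close> for the estimate itself,
  and at most \<open>\<alpha> * v m\<close> for the stepwise error, by the propagation condition.

  Gaussianity is given through linear combinations, so the Cameron-Martin step rests on the
  uniqueness theorem for characteristic functions in several dimensions.\<close>

section \<open>Characteristic functions of random vectors\<close>

text \<open>Divided by their common total mass, the weights are probability densities. The laws of
  \<open>X\<close> and \<open>Y\<close> under the reweighted measures then have the same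
  characteristic function, and uniqueness on the real line applies. The lower bound 1 keeps the
  total mass positive.\<close>

lemma weighted_Levy_uniqueness_pos:
  fixes X :: "'a \<Rightarrow> real" and Y :: "'b \<Rightarrow> real" and g :: "'a \<Rightarrow> real" and h :: "'b \<Rightarrow> real"
  assumes "prob_space M" "prob_space N"
    and [measurable]: "X \<in> borel_measurable M" "Y \<in> borel_measurable N"
      "g \<in> borel_measurable M" "h \<in> borel_measurable N"
    and g: "\<And>\<omega>. 1 \<le> g \<omega>" "\<And>\<omega>. g \<omega> \<le> C" and h: "\<And>\<omega>. 1 \<le> h \<omega>" "\<And>\<omega>. h \<omega> \<le> C"
    and eq: "\<And>t. (CLINT \<omega>|M. of_real (g \<omega>) * iexp (t * X \<omega>)) = (CLINT \<omega>|N. of_real (h \<omega>) * iexp (t * Y \<omega>))"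
    and [measurable]: "A \<in> sets borel"
  shows "(LINT \<omega>|M. g \<omega> * indicator A (X \<omega>)) = (LINT \<omega>|N. h \<omega> * indicator A (Y \<omega>))"
proof -
  interpret M: prob_space M by fact
  interpret N: prob_space N by fact
  define \<kappa> where "\<kappa> = (LINT \<omega>|M. g \<omega>)"
  have g0: "0 \<le> g \<omega>" for \<omega> using g(1)[of \<omega>] by linarith
  have h0: "0 \<le> h \<omega>" for \<omega> using h(1)[of \<omega>] by linarith
  have gi: "integrable M g"
    by (rule M.integrable_const_bound[of _ C]) (simp_all add: g g0)
  have hi: "integrable N h"
    by (rule N.integrable_const_bound[of _ C]) (simp_all add: h h0)
  \<comment> \<open>At t = 0 the hypothesis compares the total masses, so a single constant
    normalises both weights.\<close>
  have \<kappa>2: "\<kappa> = (LINT \<omega>|N. h \<omega>)"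
    using eq[of 0] by (simp add: \<kappa>_def)
  have "(LINT \<omega>|M. 1) \<le> \<kappa>"
    unfolding \<kappa>_def by (intro integral_mono gi) (auto simp: g)
  hence \<kappa>: "\<kappa> > 0" by (simp add: M.prob_space)
  define P where "P = distr (density M (\<lambda>\<omega>. ennreal (g \<omega> / \<kappa>))) borel X"
  define Q where "Q = distr (density N (\<lambda>\<omega>. ennreal (h \<omega> / \<kappa>))) borel Y"
  have P: "real_distribution P" unfolding P_def
  proof (intro prob_space.real_distribution_distr prob_spaceI)
    have "emeasure (density M (\<lambda>\<omega>. ennreal (g \<omega> / \<kappa>))) (space M) = (\<integral>\<^sup>+\<omega>. ennreal (g \<omega> / \<kappa>) \<partial>M)"
      by (subst emeasure_density) (auto intro!: nn_integral_cong)
    also have "\<dots> = ennreal (LINT \<omega>|M. g \<omega> / \<kappa>)"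
      using \<kappa> g0 by (intro nn_integral_eq_integral) (auto intro!: gi)
    also have "\<dots> = 1" using \<kappa> by (simp add: \<kappa>_def)
    finally show "emeasure (density M (\<lambda>\<omega>. ennreal (g \<omega> / \<kappa>))) (space (density M (\<lambda>\<omega>. ennreal (g \<omega> / \<kappa>)))) = 1"
      by simp
  qed simp
  have Q: "real_distribution Q" unfolding Q_def
  proof (intro prob_space.real_distribution_distr prob_spaceI)
    have "emeasure (density N (\<lambda>\<omega>. ennreal (h \<omega> / \<kappa>))) (space N) = (\<integral>\<^sup>+\<omega>. ennreal (h \<omega> / \<kappa>) \<partial>N)"
      by (subst emeasure_density) (auto intro!: nn_integral_cong)
    also have "\<dots> = ennreal (LINT \<omega>|N. h \<omega> / \<kappa>)"
      using \<kappa> h0 by (intro nn_integral_eq_integral) (auto intro!: hi)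
    also have "\<dots> = 1" using \<kappa> by (simp add: \<kappa>2)
    finally show "emeasure (density N (\<lambda>\<omega>. ennreal (h \<omega> / \<kappa>))) (space (density N (\<lambda>\<omega>. ennreal (h \<omega> / \<kappa>)))) = 1"
      by simp
  qed simp
  have intP: "integral\<^sup>L P f = (1 / \<kappa>) *\<^sub>R (LINT \<omega>|M. g \<omega> *\<^sub>R f (X \<omega>))"
    if [measurable]: "f \<in> borel_measurable borel" for f :: "real \<Rightarrow> 'c :: {banach, second_countable_topology}"
    unfolding P_def using \<kappa> g0
    by (simp add: integral_distr integral_density divide_inverse_commute flip: scaleR_scaleR)
  have intQ: "integral\<^sup>L Q f = (1 / \<kappa>) *\<^sub>R (LINT \<omega>|N. h \<omega> *\<^sub>R f (Y \<omega>))"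
    if [measurable]: "f \<in> borel_measurable borel" for f :: "real \<Rightarrow> 'c :: {banach, second_countable_topology}"
    unfolding Q_def using \<kappa> h0
    by (simp add: integral_distr integral_density divide_inverse_commute flip: scaleR_scaleR)
  have "char P = char Q"
    unfolding char_def using eq by (intro ext) (simp add: intP intQ scaleR_conv_of_real)
  hence "P = Q" by (intro Levy_uniqueness P Q)
  thus ?thesis using \<kappa> intP[of "indicator A :: real \<Rightarrow> real"] intQ[of "indicator A :: real \<Rightarrow> real"]
    by simp
qed

text \<open>Characteristic functions are Hermitian, so the hypothesis for a complex weight passes to its
  conjugate, hence to its real and imaginary parts; adding a constant makes these positive.\<close>

lemma weighted_Levy_uniqueness:
  fixes X :: "'a \<Rightarrow> real" and Y :: "'b \<Rightarrow> real" and g :: "'a \<Rightarrow> complex" and h :: "'b \<Rightarrow> complex"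
  assumes "prob_space M" "prob_space N"
    and [measurable]: "X \<in> borel_measurable M" "Y \<in> borel_measurable N"
      "g \<in> borel_measurable M" "h \<in> borel_measurable N"
    and g: "\<And>\<omega>. cmod (g \<omega>) \<le> C" and h: "\<And>\<omega>. cmod (h \<omega>) \<le> C"
    and eq0: "\<And>t. (CLINT \<omega>|M. iexp (t * X \<omega>)) = (CLINT \<omega>|N. iexp (t * Y \<omega>))"
    and eq: "\<And>t. (CLINT \<omega>|M. g \<omega> * iexp (t * X \<omega>)) = (CLINT \<omega>|N. h \<omega> * iexp (t * Y \<omega>))"
    and [measurable]: "A \<in> sets borel"
  shows "(CLINT \<omega>|M. g \<omega> * indicator A (X \<omega>)) = (CLINT \<omega>|N. h \<omega> * indicator A (Y \<omega>))"
proof -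
  interpret M: prob_space M by fact
  interpret N: prob_space N by fact
  have C: "0 \<le> C" using order_trans[OF norm_ge_zero g] .
  have intM: "integrable M f" if "f \<in> borel_measurable M" "\<And>\<omega>. norm (f \<omega>) \<le> D"
    for f :: "'a \<Rightarrow> 'c :: {banach, second_countable_topology}" and D
    using that by (intro M.integrable_const_bound[of _ D]) auto
  have intN: "integrable N f" if "f \<in> borel_measurable N" "\<And>\<omega>. norm (f \<omega>) \<le> D"
    for f :: "'b \<Rightarrow> 'c :: {banach, second_countable_topology}" and D
    using that by (intro N.integrable_const_bound[of _ D]) auto
  have real_case: "(LINT \<omega>|M. p \<omega> * indicator A (X \<omega>)) = (LINT \<omega>|N. q \<omega> * indicator A (Y \<omega>))"
    if [measurable]: "p \<in> borel_measurable M" "q \<in> borel_measurable N"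
      and p: "\<And>\<omega>. \<bar>p \<omega>\<bar> \<le> C" and q: "\<And>\<omega>. \<bar>q \<omega>\<bar> \<le> C"
      and pq: "\<And>t. (CLINT \<omega>|M. of_real (p \<omega>) * iexp (t * X \<omega>)) = (CLINT \<omega>|N. of_real (q \<omega>) * iexp (t * Y \<omega>))"
    for p q
  proof -
    have 1: "integrable M (\<lambda>\<omega>. of_real (p \<omega>) * iexp (t * X \<omega>))" "integrable M (\<lambda>\<omega>. iexp (t * X \<omega>))"
      "integrable N (\<lambda>\<omega>. of_real (q \<omega>) * iexp (t * Y \<omega>))" "integrable N (\<lambda>\<omega>. iexp (t * Y \<omega>))" for t
      by (rule intM[of _ C] intM[of _ 1] intN[of _ C] intN[of _ 1]; use p q in \<open>simp add: norm_mult del: of_real_mult\<close>)+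
    have [measurable]: "(\<lambda>\<omega>. p \<omega> + (C + 1)) \<in> borel_measurable M" "(\<lambda>\<omega>. q \<omega> + (C + 1)) \<in> borel_measurable N"
      by simp_all
    \<comment> \<open>The weights moved by C + 1 lie between 1 and 2C + 1, and by linearity their
      characteristic integrals agree, from \<open>pq\<close> and \<open>eq0\<close>. The added
      constant is removed afterwards by means of the weight 1 in fact \<open>3\<close>.\<close>
    have 2: "(LINT \<omega>|M. (p \<omega> + (C + 1)) * indicator A (X \<omega>)) = (LINT \<omega>|N. (q \<omega> + (C + 1)) * indicator A (Y \<omega>))"
    proof (rule weighted_Levy_uniqueness_pos)
      show "1 \<le> p \<omega> + (C + 1)" "p \<omega> + (C + 1) \<le> 2 * C + 1" for \<omega> using p[of \<omega>] by auto
      show "1 \<le> q \<omega> + (C + 1)" "q \<omega> + (C + 1) \<le> 2 * C + 1" for \<omega> using q[of \<omega>] by auto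
      have *: "(CLINT \<omega>|M. complex_of_real (p \<omega> + (C + 1)) * iexp (t * X \<omega>)) = (CLINT \<omega>|M. of_real (p \<omega>) * iexp (t * X \<omega>)) + of_real (C + 1) * (CLINT \<omega>|M. iexp (t * X \<omega>))" for t
        by (simp only: of_real_add[of "p _"] distrib_right integral_mult_right_zero[symmetric])
           (rule Bochner_Integration.integral_add; intro 1 integrable_mult_right)
      have **: "(CLINT \<omega>|N. complex_of_real (q \<omega> + (C + 1)) * iexp (t * Y \<omega>)) = (CLINT \<omega>|N. of_real (q \<omega>) * iexp (t * Y \<omega>)) + of_real (C + 1) * (CLINT \<omega>|N. iexp (t * Y \<omega>))" for t
        by (simp only: of_real_add[of "q _"] distrib_right integral_mult_right_zero[symmetric])
           (rule Bochner_Integration.integral_add; intro 1 integrable_mult_right)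
      show "(CLINT \<omega>|M. complex_of_real (p \<omega> + (C + 1)) * iexp (t * X \<omega>)) = (CLINT \<omega>|N. complex_of_real (q \<omega> + (C + 1)) * iexp (t * Y \<omega>))" for t
        unfolding * ** eq0 pq ..
    qed (simp_all add: assms)
    have 3: "(LINT \<omega>|M. 1 * indicator A (X \<omega>)) = (LINT \<omega>|N. 1 * indicator A (Y \<omega>) :: real)"
      by (rule weighted_Levy_uniqueness_pos[where C = 1]) (use eq0 in \<open>auto simp: M.prob_space_axioms N.prob_space_axioms\<close>)
    have pC: "\<bar>p \<omega>\<bar> \<le> C + 1" and qC: "\<bar>q \<omega>'\<bar> \<le> C + 1" for \<omega> \<omega>'
      using p[of \<omega>] q[of \<omega>'] by linarith+
    have 4: "(LINT \<omega>|M. (p \<omega> + (C + 1)) * indicator A (X \<omega>)) = (LINT \<omega>|M. p \<omega> * indicator A (X \<omega>)) + (C + 1) * (LINT \<omega>|M. 1 * indicator A (X \<omega>))"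
      unfolding distrib_right[of "p _"] integral_mult_right_zero[symmetric] mult_1
      by (rule Bochner_Integration.integral_add;
          rule intM[of _ "C + 1"]; use C in \<open>simp add: pC split: split_indicator\<close>)
    have 5: "(LINT \<omega>|N. (q \<omega> + (C + 1)) * indicator A (Y \<omega>)) = (LINT \<omega>|N. q \<omega> * indicator A (Y \<omega>)) + (C + 1) * (LINT \<omega>|N. 1 * indicator A (Y \<omega>))"
      unfolding distrib_right[of "q _"] integral_mult_right_zero[symmetric] mult_1
      by (rule Bochner_Integration.integral_add;
          rule intN[of _ "C + 1"]; use C in \<open>simp add: qC split: split_indicator\<close>)
    from 2 3 4 5 show ?thesis by simp
  qed
  have [measurable]: "cnj \<in> borel_measurable borel"
    by (intro borel_measurable_continuous_onI continuous_intros)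
  have ig: "integrable M (\<lambda>\<omega>. g \<omega> * iexp (t * X \<omega>))" "integrable M (\<lambda>\<omega>. cnj (g \<omega>) * iexp (t * X \<omega>))"
    "integrable M (\<lambda>\<omega>. g \<omega> * indicator A (X \<omega>))" for t
    by (rule intM[of _ C], measurable; use g C in \<open>simp add: norm_mult split: split_indicator del: of_real_mult\<close>)+
  have ih: "integrable N (\<lambda>\<omega>. h \<omega> * iexp (t * Y \<omega>))" "integrable N (\<lambda>\<omega>. cnj (h \<omega>) * iexp (t * Y \<omega>))"
    "integrable N (\<lambda>\<omega>. h \<omega> * indicator A (Y \<omega>))" for t
    by (rule intN[of _ C], measurable; use h C in \<open>simp add: norm_mult split: split_indicator del: of_real_mult\<close>)+
  have cnj: "(CLINT \<omega>|M. cnj (g \<omega>) * iexp (t * X \<omega>)) = (CLINT \<omega>|N. cnj (h \<omega>) * iexp (t * Y \<omega>))" for t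
  proof -
    have "(CLINT \<omega>|M. cnj (g \<omega>) * iexp (t * X \<omega>)) = cnj (CLINT \<omega>|M. g \<omega> * iexp (- t * X \<omega>))"
      by (simp add: exp_cnj del: Bochner_Integration.integral_cnj flip: Bochner_Integration.integral_cnj)
    also have "\<dots> = cnj (CLINT \<omega>|N. h \<omega> * iexp (- t * Y \<omega>))" by (simp only: eq)
    also have "\<dots> = (CLINT \<omega>|N. cnj (h \<omega>) * iexp (t * Y \<omega>))"
      by (simp add: exp_cnj del: Bochner_Integration.integral_cnj flip: Bochner_Integration.integral_cnj)
    finally show ?thesis .
  qed
  have Re: "complex_of_real (Re w) = (w + cnj w) / 2" for w by (simp add: complex_add_cnj)
  \<comment> \<open>Keeping the exponential \<open>e\<close> inside the bracket leaves the constant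
    -i/2 as the outer factor, so that it can be pulled out of the integral.\<close>
  have Im: "complex_of_real (Im w) * e = (w * e - cnj w * e) * (- \<i> / 2)" for w e
  proof -
    have "complex_of_real (Im w) = (w - cnj w) * (- \<i> / 2)" by (simp add: complex_eq_iff)
    moreover have "(w - cnj w) * c * e = (w * e - cnj w * e) * c" for c by (simp add: algebra_simps)
    ultimately show ?thesis by (simp only:)
  qed
  have "(LINT \<omega>|M. Re (g \<omega>) * indicator A (X \<omega>)) = (LINT \<omega>|N. Re (h \<omega>) * indicator A (Y \<omega>))"
  proof (rule real_case)
    show "\<bar>Re (g \<omega>)\<bar> \<le> C" for \<omega> using abs_Re_le_cmod g order_trans by blast
    show "\<bar>Re (h \<omega>)\<bar> \<le> C" for \<omega> using abs_Re_le_cmod h order_trans by blast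
    show "(CLINT \<omega>|M. of_real (Re (g \<omega>)) * iexp (t * X \<omega>)) = (CLINT \<omega>|N. of_real (Re (h \<omega>)) * iexp (t * Y \<omega>))" for t
      unfolding Re using ig ih eq[of t] cnj[of t]
      by (simp add: add_divide_distrib distrib_right del: of_real_mult)
  qed measurable
  moreover have "(LINT \<omega>|M. Im (g \<omega>) * indicator A (X \<omega>)) = (LINT \<omega>|N. Im (h \<omega>) * indicator A (Y \<omega>))"
  proof (rule real_case)
    show "\<bar>Im (g \<omega>)\<bar> \<le> C" for \<omega> using abs_Im_le_cmod g order_trans by blast
    show "\<bar>Im (h \<omega>)\<bar> \<le> C" for \<omega> using abs_Im_le_cmod h order_trans by blast
    show "(CLINT \<omega>|M. of_real (Im (g \<omega>)) * iexp (t * X \<omega>)) = (CLINT \<omega>|N. of_real (Im (h \<omega>)) * iexp (t * Y \<omega>))" for t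
      unfolding Im integral_mult_left_zero using ig ih eq[of t] cnj[of t]
      by (simp del: of_real_mult)
  qed measurable
  moreover have "Re (w * indicator A x) = Re w * indicator A x" "Im (w * indicator A x) = Im w * indicator A x" for w and x :: real
    by (auto split: split_indicator)
  ultimately show ?thesis
    using ig(3) ih(3) by (intro complex_eqI) (simp_all flip: integral_Re integral_Im)
qed

text \<open>The weights make the induction on \<open>I\<close> go through: one coordinate at a time is moved from
  the exponential into the weight, where it appears as an indicator.\<close>

lemma weighted_char_fun_uniqueness:
  fixes X :: "'i \<Rightarrow> 'a \<Rightarrow> real" and Y :: "'i \<Rightarrow> 'b \<Rightarrow> real"
  assumes "prob_space M" "prob_space N"
    and "finite I"
    and "\<And>k. k \<in> I \<Longrightarrow> X k \<in> borel_measurable M" "\<And>k. k \<in> I \<Longrightarrow> Y k \<in> borel_measurable N"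
    and "g \<in> borel_measurable M" "h \<in> borel_measurable N"
    and "\<And>\<omega>. cmod (g \<omega>) \<le> C" "\<And>\<omega>. cmod (h \<omega>) \<le> C"
    and "\<And>c. (CLINT \<omega>|M. iexp (\<Sum>k\<in>I. c k * X k \<omega>)) = (CLINT \<omega>|N. iexp (\<Sum>k\<in>I. c k * Y k \<omega>))"
    and "\<And>c. (CLINT \<omega>|M. g \<omega> * iexp (\<Sum>k\<in>I. c k * X k \<omega>)) = (CLINT \<omega>|N. h \<omega> * iexp (\<Sum>k\<in>I. c k * Y k \<omega>))"
    and "\<And>k. k \<in> I \<Longrightarrow> A k \<in> sets borel"
  shows "(CLINT \<omega>|M. g \<omega> * (\<Prod>k\<in>I. indicator (A k) (X k \<omega>))) = (CLINT \<omega>|N. h \<omega> * (\<Prod>k\<in>I. indicator (A k) (Y k \<omega>)))"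
  using assms(3-)
proof (induction I arbitrary: g h rule: finite_induct)
  case empty
  then show ?case by simp
next
  case (insert j I)
  note [measurable] = insert.prems(1,2)[OF insertI1] insert.prems(1,2)[OF insertI2]
    insert.prems(3,4) insert.prems(9)[OF insertI1]
  have split: "(\<Sum>k\<in>insert j I. c k * z k) = c j * z j + (\<Sum>k\<in>I. c k * z k)" for c z :: "'i \<Rightarrow> real"
    using insert.hyps by simp
  have upd: "(\<Sum>k\<in>I. (c(j := t)) k * z k) = (\<Sum>k\<in>I. c k * z k)" for c z :: "'i \<Rightarrow> real" and t
    using insert.hyps by (intro sum.cong) auto
  have bound: "cmod (w * indicator S x) \<le> C" if "cmod w \<le> C" for w S and x :: real
    using that order_trans[OF norm_ge_zero that] by (auto split: split_indicator)
  have "(CLINT \<omega>|M. (g \<omega> * indicator (A j) (X j \<omega>)) * (\<Prod>k\<in>I. indicator (A k) (X k \<omega>)))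
      = (CLINT \<omega>|N. (h \<omega> * indicator (A j) (Y j \<omega>)) * (\<Prod>k\<in>I. indicator (A k) (Y k \<omega>)))"
  proof (rule insert.IH)
    show "X k \<in> borel_measurable M" "Y k \<in> borel_measurable N" "A k \<in> sets borel" if "k \<in> I" for k
      using that insert.prems by auto
    show "(\<lambda>\<omega>. g \<omega> * indicator (A j) (X j \<omega>)) \<in> borel_measurable M"
      "(\<lambda>\<omega>. h \<omega> * indicator (A j) (Y j \<omega>)) \<in> borel_measurable N"
      by measurable
    show "cmod (g \<omega> * indicator (A j) (X j \<omega>)) \<le> C" "cmod (h \<omega>' * indicator (A j) (Y j \<omega>')) \<le> C" for \<omega> \<omega>'
      using bound insert.prems(5,6) by blast+
    \<comment> \<open>The coefficient t of coordinate j is free: t = 0 gives the unweighted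
      hypothesis for \<open>I\<close>, and c = 0 the one for coordinate j alone.\<close>
    have drop: "(CLINT \<omega>|M. iexp (t * X j \<omega> + (\<Sum>k\<in>I. c k * X k \<omega>)))
        = (CLINT \<omega>|N. iexp (t * Y j \<omega> + (\<Sum>k\<in>I. c k * Y k \<omega>)))" for c t
      using insert.prems(7)[of "c(j := t)"] unfolding split upd by simp
    show "(CLINT \<omega>|M. iexp (\<Sum>k\<in>I. c k * X k \<omega>)) = (CLINT \<omega>|N. iexp (\<Sum>k\<in>I. c k * Y k \<omega>))" for c
      using drop[of 0 c] by simp
    fix c :: "'i \<Rightarrow> real"
    \<comment> \<open>The exponential of the remaining coordinates has modulus 1, so it joins the
      weight without changing the bound \<open>C\<close>. The one-dimensional result then replaces
      the exponential in coordinate j by an indicator.\<close>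
    have "(CLINT \<omega>|M. (g \<omega> * iexp (\<Sum>k\<in>I. c k * X k \<omega>)) * indicator (A j) (X j \<omega>))
        = (CLINT \<omega>|N. (h \<omega> * iexp (\<Sum>k\<in>I. c k * Y k \<omega>)) * indicator (A j) (Y j \<omega>))"
    proof (rule weighted_Levy_uniqueness[OF assms(1,2)])
      show "cmod (g \<omega> * iexp (\<Sum>k\<in>I. c k * X k \<omega>)) \<le> C" "cmod (h \<omega>' * iexp (\<Sum>k\<in>I. c k * Y k \<omega>')) \<le> C" for \<omega> \<omega>'
        using insert.prems(5,6) by (simp_all add: norm_mult del: of_real_sum)
      show "(CLINT \<omega>|M. iexp (t * X j \<omega>)) = (CLINT \<omega>|N. iexp (t * Y j \<omega>))" for t
        using drop[of t "\<lambda>_. 0"] by simp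
      have "(CLINT \<omega>|M. g \<omega> * iexp (t * X j \<omega> + (\<Sum>k\<in>I. c k * X k \<omega>)))
          = (CLINT \<omega>|N. h \<omega> * iexp (t * Y j \<omega> + (\<Sum>k\<in>I. c k * Y k \<omega>)))" for t
        using insert.prems(8)[of "c(j := t)"] unfolding split upd by simp
      then show "(CLINT \<omega>|M. (g \<omega> * iexp (\<Sum>k\<in>I. c k * X k \<omega>)) * iexp (t * X j \<omega>))
          = (CLINT \<omega>|N. (h \<omega> * iexp (\<Sum>k\<in>I. c k * Y k \<omega>)) * iexp (t * Y j \<omega>))" for t
        by (simp add: distrib_left exp_add mult_ac del: of_real_sum of_real_mult)
    qed measurable
    then show "(CLINT \<omega>|M. (g \<omega> * indicator (A j) (X j \<omega>)) * iexp (\<Sum>k\<in>I. c k * X k \<omega>))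
        = (CLINT \<omega>|N. (h \<omega> * indicator (A j) (Y j \<omega>)) * iexp (\<Sum>k\<in>I. c k * Y k \<omega>))"
      by (simp only: mult_ac)
  qed
  then show ?case using insert.hyps by (simp add: mult_ac)
qed

text \<open>Measurable rectangles determine a finite measure on the product space. The mass of a
  rectangle is the integral of a product of indicators, and the weighted result with both weights
  equal to 1 compares these integrals.\<close>

lemma Levy_uniqueness_PiM:
  fixes X :: "'i \<Rightarrow> 'a \<Rightarrow> real" and Y :: "'i \<Rightarrow> 'b \<Rightarrow> real"
  assumes M: "prob_space M" and N: "prob_space N" and I: "finite I"
    and X: "\<And>k. k \<in> I \<Longrightarrow> X k \<in> borel_measurable M" and Y: "\<And>k. k \<in> I \<Longrightarrow> Y k \<in> borel_measurable N"
    and eq: "\<And>c. (CLINT \<omega>|M. iexp (\<Sum>k\<in>I. c k * X k \<omega>)) = (CLINT \<omega>|N. iexp (\<Sum>k\<in>I. c k * Y k \<omega>))"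
  shows "distr M (\<Pi>\<^sub>M k\<in>I. borel) (\<lambda>\<omega>. \<lambda>k\<in>I. X k \<omega>) = distr N (\<Pi>\<^sub>M k\<in>I. borel) (\<lambda>\<omega>. \<lambda>k\<in>I. Y k \<omega>)"
    (is "?P = ?Q")
proof -
  interpret M: prob_space M by fact
  interpret N: prob_space N by fact
  note [measurable] = X Y
  interpret P: prob_space ?P by (intro M.prob_space_distr) measurable
  interpret Q: prob_space ?Q by (intro N.prob_space_distr) measurable
  show ?thesis
  proof (rule measure_eqI_PiM_finite[OF I, where A = "\<lambda>_. space (\<Pi>\<^sub>M k\<in>I. borel)"])
    fix A :: "'i \<Rightarrow> real set" assume A: "\<And>k. k \<in> I \<Longrightarrow> A k \<in> sets borel"
    have meas: "Pi\<^sub>E I A \<in> sets (\<Pi>\<^sub>M k\<in>I. borel)"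
      using A I by (intro sets_PiM_I_finite)
    have prod: "(\<Prod>k\<in>I. indicator (A k) (x k)) = (indicator (Pi\<^sub>E I A) (\<lambda>k\<in>I. x k) :: complex)" for x :: "'i \<Rightarrow> real"
    proof (cases "\<forall>k\<in>I. x k \<in> A k")
      case False
      then obtain k where "k \<in> I" "x k \<notin> A k" by auto
      then have "(\<Prod>k\<in>I. indicator (A k) (x k) :: complex) = 0"
        using I by (intro prod_zero bexI[of _ k]) auto
      with \<open>k \<in> I\<close> \<open>x k \<notin> A k\<close> show ?thesis by (auto simp: indicator_def PiE_iff)
    qed (auto simp: indicator_def PiE_iff)
    have mP: "P.prob (Pi\<^sub>E I A) = (CLINT \<omega>|M. 1 * (\<Prod>k\<in>I. indicator (A k) (X k \<omega>)))"
    proof -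
      have "of_real (P.prob (Pi\<^sub>E I A)) = (CLINT x|?P. of_real (indicator (Pi\<^sub>E I A) x))"
        unfolding integral_complex_of_real using meas by simp
      also have "\<dots> = (CLINT x|?P. indicator (Pi\<^sub>E I A) x)"
        by (simp only: of_real_indicator)
      also have "\<dots> = (CLINT \<omega>|M. indicator (Pi\<^sub>E I A) (\<lambda>k\<in>I. X k \<omega>))"
        by (intro integral_distr borel_measurable_indicator meas) measurable
      finally show ?thesis by (simp add: prod)
    qed
    have mQ: "Q.prob (Pi\<^sub>E I A) = (CLINT \<omega>|N. 1 * (\<Prod>k\<in>I. indicator (A k) (Y k \<omega>)))"
    proof -
      have "of_real (Q.prob (Pi\<^sub>E I A)) = (CLINT x|?Q. of_real (indicator (Pi\<^sub>E I A) x))"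
        unfolding integral_complex_of_real using meas by simp
      also have "\<dots> = (CLINT x|?Q. indicator (Pi\<^sub>E I A) x)"
        by (simp only: of_real_indicator)
      also have "\<dots> = (CLINT \<omega>|N. indicator (Pi\<^sub>E I A) (\<lambda>k\<in>I. Y k \<omega>))"
        by (intro integral_distr borel_measurable_indicator meas) measurable
      finally show ?thesis by (simp add: prod)
    qed
    have "complex_of_real (P.prob (Pi\<^sub>E I A)) = Q.prob (Pi\<^sub>E I A)"
      unfolding mP mQ
      by (rule weighted_char_fun_uniqueness[OF M N I, where C = 1]) (use X Y eq A in auto)
    then show "?P (Pi\<^sub>E I A) = ?Q (Pi\<^sub>E I A)"
      by (simp add: P.emeasure_eq_measure Q.emeasure_eq_measure)
  next
    have "Pi\<^sub>E I (\<lambda>_. UNIV) \<in> prod_algebra I (\<lambda>_. borel :: real measure)"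
      using I by (intro prod_algebraI_finite) auto
    then show "range (\<lambda>_. space (\<Pi>\<^sub>M k\<in>I. borel)) \<subseteq> prod_algebra I (\<lambda>_. borel :: real measure)"
      by (auto simp: space_PiM)
  qed (auto simp: P.emeasure_eq_measure)
qed

section \<open>Shifts of Gaussian vectors\<close>

lemma (in prob_space) gaussian_rv_integrable:
  assumes "gaussian_rv M Y"
  shows gaussian_rv_measurable: "Y \<in> borel_measurable M"
    and gaussian_rv_integrable1: "integrable M Y"
    and gaussian_rv_integrable2: "integrable M (\<lambda>\<omega>. (Y \<omega>)\<^sup>2)"
proof -
  consider (normal) \<mu> \<sigma> where "0 < \<sigma>" "distributed M lborel Y (\<lambda>x. ennreal (normal_density \<mu> \<sigma> x))"
    | (const) \<mu> where "Y \<in> borel_measurable M" "AE \<omega> in M. Y \<omega> = \<mu>"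
    using assms unfolding gaussian_rv_def by auto
  then have "Y \<in> borel_measurable M \<and> integrable M Y \<and> integrable M (\<lambda>\<omega>. (Y \<omega>)\<^sup>2)"
  proof cases
    case normal
    note D = normal(2)
    have [measurable]: "Y \<in> borel_measurable M"
      using distributed_measurable[OF D] by simp
    have 1: "integrable M Y"
      using integrable_normal_moment_nz_1[OF normal(1), of \<mu>] distributed_integrable_var[OF D] by simp
    have "integrable M (\<lambda>\<omega>. (Y \<omega> - \<mu>)\<^sup>2)"
      using integrable_normal_moment[OF normal(1), of \<mu> 2] distributed_integrable[OF D, of "\<lambda>x. (x - \<mu>)\<^sup>2"]
      by simp
    then have "integrable M (\<lambda>\<omega>. (Y \<omega> - \<mu>)\<^sup>2 + 2 * \<mu> * Y \<omega> - \<mu>\<^sup>2)"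
      using 1 by (intro Bochner_Integration.integrable_diff Bochner_Integration.integrable_add) auto
    then show ?thesis using 1 by (simp add: power2_eq_square algebra_simps)
  next
    case const
    have "integrable M Y \<longleftrightarrow> integrable M (\<lambda>_. \<mu>)"
      using const by (intro integrable_cong_AE) auto
    moreover have "integrable M (\<lambda>\<omega>. (Y \<omega>)\<^sup>2) \<longleftrightarrow> integrable M (\<lambda>_. \<mu>\<^sup>2)"
      using const by (intro integrable_cong_AE) auto
    ultimately show ?thesis using const by simp
  qed
  then show "Y \<in> borel_measurable M" "integrable M Y" "integrable M (\<lambda>\<omega>. (Y \<omega>)\<^sup>2)" by auto
qed

text \<open>For positive variance, dividing by \<sigma> reduces this to the standard normal
  characteristic function. A point mass with mean zero vanishes almost surely, and both sides are
  1.\<close>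

lemma (in prob_space) gaussian_rv_char:
  assumes Y: "gaussian_rv M Y" and mean: "expectation Y = 0"
  shows "(CLINT \<omega>|M. iexp (t * Y \<omega>)) = exp (- t\<^sup>2 * expectation (\<lambda>\<omega>. (Y \<omega>)\<^sup>2) / 2)"
proof -
  note [measurable] = gaussian_rv_measurable[OF Y]
  consider (normal) \<mu> \<sigma> where "0 < \<sigma>" "distributed M lborel Y (\<lambda>x. ennreal (normal_density \<mu> \<sigma> x))"
    | (const) \<mu> where "Y \<in> borel_measurable M" "AE \<omega> in M. Y \<omega> = \<mu>"
    using Y unfolding gaussian_rv_def by auto
  then show ?thesis
  proof cases
    case normal
    have "\<mu> = 0" using normal_distributed_expectation[OF normal] mean by simp
    with normal have D: "distributed M lborel (\<lambda>\<omega>. Y \<omega> / \<sigma>) std_normal_density"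
      using normal_standard_normal_convert[OF normal(1), of Y 0] by simp
    have var: "expectation (\<lambda>\<omega>. (Y \<omega>)\<^sup>2) = \<sigma>\<^sup>2"
      using normal_distributed_variance[OF normal] mean by simp
    have "(CLINT \<omega>|M. iexp (t * Y \<omega>)) = (CLINT \<omega>|M. iexp ((t * \<sigma>) * (Y \<omega> / \<sigma>)))"
      using normal(1) by simp
    also have "\<dots> = (CLINT x|distr M lborel (\<lambda>\<omega>. Y \<omega> / \<sigma>). iexp ((t * \<sigma>) * x))"
      by (subst integral_distr) auto
    also have "\<dots> = char std_normal_distribution (t * \<sigma>)"
      unfolding distributed_distr_eq_density[OF D] char_def ..
    also have "\<dots> = exp (- t\<^sup>2 * expectation (\<lambda>\<omega>. (Y \<omega>)\<^sup>2) / 2)"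
      unfolding char_std_normal_distribution var by (simp add: power_mult_distrib)
    finally show ?thesis .
  next
    case const
    have "expectation Y = \<mu>"
      using integral_cong_AE[of Y M "\<lambda>_. \<mu>"] const by (simp add: prob_space)
    with mean const have ae: "AE \<omega> in M. Y \<omega> = 0" by simp
    have "(CLINT \<omega>|M. iexp (t * Y \<omega>)) = (CLINT \<omega>|M. 1)"
      by (rule integral_cong_AE) (use ae in auto)
    moreover have "expectation (\<lambda>\<omega>. (Y \<omega>)\<^sup>2) = expectation (\<lambda>\<omega>. 0)"
      by (rule integral_cong_AE) (use ae in auto)
    ultimately show ?thesis by (simp add: prob_space)
  qed
qed

lemma integrable_mult_of_squares:
  fixes f g :: "'a \<Rightarrow> real"
  assumes [measurable]: "f \<in> borel_measurable M" "g \<in> borel_measurable M"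
    and "integrable M (\<lambda>x. (f x)\<^sup>2)" "integrable M (\<lambda>x. (g x)\<^sup>2)"
  shows "integrable M (\<lambda>x. f x * g x)"
proof (rule Bochner_Integration.integrable_bound)
  show "integrable M (\<lambda>x. (f x)\<^sup>2 + (g x)\<^sup>2)" using assms by auto
  show "AE x in M. norm (f x * g x) \<le> norm ((f x)\<^sup>2 + (g x)\<^sup>2)"
  proof (intro AE_I2)
    fix x
    have "\<bar>f x * g x\<bar> \<le> (f x)\<^sup>2 + (g x)\<^sup>2"
      using sum_squares_bound[of "\<bar>f x\<bar>" "\<bar>g x\<bar>"] abs_ge_zero[of "f x * g x"]
      unfolding abs_mult power2_abs by linarith
    then show "norm (f x * g x) \<le> norm ((f x)\<^sup>2 + (g x)\<^sup>2)" by simp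
  qed
qed measurable

text \<open>Completing the square. The case u = 1 is the one-dimensional Cameron-Martin formula for
  a shift by s; the case u = 2 yields the second moment of its density.\<close>

lemma normal_density_tilt:
  assumes "0 < s"
  shows "normal_density 0 (sqrt s) y * exp (u * y - u\<^sup>2 * s / 2) = normal_density (u * s) (sqrt s) y"
proof -
  have "- y\<^sup>2 / (2 * s) + (u * y - u\<^sup>2 * s / 2) = - (y - u * s)\<^sup>2 / (2 * s)"
    using assms by (simp add: field_simps power2_eq_square)
  then show ?thesis
    using assms by (simp add: normal_density_def mult_exp_exp flip: exp_add)
qed

text \<open>With \<Sigma> the covariance matrix of \<xi>, the hypothesis \<open>shift\<close> says b
  = \<Sigma> a, so the exponent is the variance of the linear form with coefficients
  \<open>a\<close>. In this form the bound also covers degenerate laws.\<close>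

lemma gaussian_shift_bound:
  fixes \<xi> :: "'i \<Rightarrow> 'a \<Rightarrow> real" and a b :: "'i \<Rightarrow> real" and f :: "('i \<Rightarrow> real) \<Rightarrow> ennreal"
  assumes M: "prob_space M" and I: "finite I"
    and gauss: "\<And>c. gaussian_rv M (\<lambda>\<omega>. \<Sum>k\<in>I. c k * \<xi> k \<omega>)"
    and mean: "\<And>k. k \<in> I \<Longrightarrow> prob_space.expectation M (\<xi> k) = 0"
    and shift: "\<And>k. k \<in> I \<Longrightarrow> prob_space.expectation M (\<lambda>\<omega>. \<xi> k \<omega> * (\<Sum>j\<in>I. a j * \<xi> j \<omega>)) = b k"
    and f[measurable]: "f \<in> borel_measurable (\<Pi>\<^sub>M k\<in>I. borel)"
  shows "(\<integral>\<^sup>+\<omega>. f (\<lambda>k\<in>I. \<xi> k \<omega> + b k) \<partial>M)\<^sup>2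
    \<le> ennreal (exp (\<Sum>k\<in>I. a k * b k)) * (\<integral>\<^sup>+\<omega>. (f (\<lambda>k\<in>I. \<xi> k \<omega>))\<^sup>2 \<partial>M)"
proof -
  interpret M: prob_space M by fact
  define U where "U c \<omega> = (\<Sum>k\<in>I. c k * \<xi> k \<omega>)" for c \<omega>
  define s where "s = (\<Sum>k\<in>I. a k * b k)"
  have gU: "gaussian_rv M (U c)" for c unfolding U_def by (rule gauss)
  note U_int [simp, measurable] = M.gaussian_rv_measurable[OF gU] M.gaussian_rv_integrable1[OF gU] M.gaussian_rv_integrable2[OF gU]
  have \<xi>_eq: "\<xi> k = U (\<lambda>j. if j = k then 1 else 0)" if "k \<in> I" for k
    unfolding U_def using that I by (simp add: if_distrib[of "\<lambda>x. x * _"] cong: if_cong)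
  have \<xi>_meas [measurable]: "\<xi> k \<in> borel_measurable M" and \<xi>_int: "integrable M (\<xi> k)"
    and \<xi>_sq: "integrable M (\<lambda>\<omega>. (\<xi> k \<omega>)\<^sup>2)" if "k \<in> I" for k
    unfolding \<xi>_eq[OF that] by simp_all
  have U_mean: "M.expectation (U c) = 0" for c
    unfolding U_def using mean by (subst Bochner_Integration.integral_sum) (simp_all add: \<xi>_int)
  have UU: "M.expectation (\<lambda>\<omega>. U c \<omega> * U a \<omega>) = (\<Sum>k\<in>I. c k * b k)" for c
  proof -
    have "M.expectation (\<lambda>\<omega>. U c \<omega> * U a \<omega>) = M.expectation (\<lambda>\<omega>. \<Sum>k\<in>I. c k * (\<xi> k \<omega> * U a \<omega>))"
      by (simp add: U_def[of c] sum_distrib_right mult.assoc)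
    also have "\<dots> = (\<Sum>k\<in>I. c k * M.expectation (\<lambda>\<omega>. \<xi> k \<omega> * U a \<omega>))"
      by (subst Bochner_Integration.integral_sum)
         (auto intro!: integrable_mult_right integrable_mult_of_squares \<xi>_sq \<xi>_meas)
    also have "\<dots> = (\<Sum>k\<in>I. c k * b k)"
      using shift by (simp add: U_def)
    finally show ?thesis .
  qed
  have s: "M.expectation (\<lambda>\<omega>. (U a \<omega>)\<^sup>2) = s"
    using UU[of a] by (simp add: s_def power2_eq_square)
  have s0: "0 \<le> s" unfolding s[symmetric] by simp
  show ?thesis
  proof (cases "s = 0")
    \<comment> \<open>With variance zero, \<open>U a\<close> vanishes almost surely, which forces b
      = 0. Cauchy-Schwarz against the constant 1 is then enough.\<close>
    case True
    have "AE \<omega> in M. (U a \<omega>)\<^sup>2 = 0"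
      using s True by (subst integral_nonneg_eq_0_iff_AE[symmetric]) simp_all
    then have ae: "AE \<omega> in M. U a \<omega> = 0" by simp
    have b0: "b k = 0" if "k \<in> I" for k
    proof -
      have "b k = M.expectation (\<lambda>\<omega>. \<xi> k \<omega> * U a \<omega>)"
        using shift[OF that] by (simp add: U_def)
      also have "\<dots> = M.expectation (\<lambda>\<omega>. 0)"
        using ae that by (intro integral_cong_AE) auto
      finally show ?thesis by simp
    qed
    then have "(\<lambda>k\<in>I. \<xi> k \<omega> + b k) = (\<lambda>k\<in>I. \<xi> k \<omega>)" for \<omega> by auto
    moreover have "(\<integral>\<^sup>+\<omega>. f (\<lambda>k\<in>I. \<xi> k \<omega>) * 1 \<partial>M)\<^sup>2 \<le> (\<integral>\<^sup>+\<omega>. (f (\<lambda>k\<in>I. \<xi> k \<omega>))\<^sup>2 \<partial>M) * (\<integral>\<^sup>+\<omega>. 1\<^sup>2 \<partial>M)"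
      by (rule Cauchy_Schwarz_nn_integral) measurable
    ultimately show ?thesis using True by (simp add: s_def M.emeasure_space_1)
  next
    case False
    with s0 have s0: "0 < s" by simp
    define n where "n = density lborel (\<lambda>x. ennreal (normal_density 0 (sqrt s) x))"
    interpret n: prob_space n
      unfolding n_def using s0 by (intro prob_space_normal_density) simp
    have [measurable_cong]: "sets n = sets borel" by (simp add: n_def)
    interpret P: pair_prob_space M n ..
    have dn: "distributed n lborel (\<lambda>x. x) (\<lambda>x. ennreal (normal_density 0 (sqrt s) x))"
      by (simp add: distributed_def n_def distr_id2 cong: distr_cong)
    have gn: "gaussian_rv n (\<lambda>x. x)"
      unfolding gaussian_rv_def using dn s0 by (intro disjI1 exI[of _ 0] exI[of _ "sqrt s"]) simp
    have n_mean: "n.expectation (\<lambda>x. x) = 0"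
      using n.normal_distributed_expectation[OF _ dn] s0 by simp
    then have n_var: "n.expectation (\<lambda>x. x\<^sup>2) = s"
      using n.normal_distributed_variance[OF _ dn] s0 by simp
    \<comment> \<open>\<open>\<xi>\<close> has the law of \<open>\<zeta> + (b / s) N\<close> with \<open>N \<sim> N(0, s)\<close> independent of the residual \<open>\<zeta>\<close>
      of the regression on \<open>U a\<close>, so shifting \<open>\<xi>\<close> by \<open>b\<close> amounts to shifting \<open>N\<close> by \<open>s\<close>.\<close>
    define \<zeta> where "\<zeta> k \<omega> = \<xi> k \<omega> - b k / s * U a \<omega>" for k \<omega>
    define Y where "Y k p = \<zeta> k (fst p) + b k / s * snd p" for k and p :: "'a \<times> real"
    have [measurable]: "\<zeta> k \<in> borel_measurable M" if "k \<in> I" for k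
      unfolding \<zeta>_def using that by measurable
    have [measurable]: "Y k \<in> borel_measurable (M \<Otimes>\<^sub>M n)" if "k \<in> I" for k
      unfolding Y_def using that by measurable
    have char: "(CLINT \<omega>|M. iexp (\<Sum>k\<in>I. c k * \<xi> k \<omega>)) = (CLINT p|M \<Otimes>\<^sub>M n. iexp (\<Sum>k\<in>I. c k * Y k p))" for c
    proof -
      define q where "q = (\<Sum>k\<in>I. c k * b k)"
      \<comment> \<open>\<open>U d\<close> is the residual of \<open>U c\<close> after regression on
        \<open>U a\<close>; being a linear form in \<xi>, it is Gaussian. Its variance is smaller
        than that of \<open>U c\<close> by q^2 / s, which is the variance that the independent term
        (q / s) N puts back.\<close>
      define d where "d k = c k - q / s * a k" for k
      have Ud: "U d \<omega> = U c \<omega> - q / s * U a \<omega>" for \<omega>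
        by (simp add: U_def d_def left_diff_distrib sum_subtractf sum_distrib_left mult.assoc)
      have cY: "(\<Sum>k\<in>I. c k * Y k p) = U d (fst p) + q / s * snd p" for p
      proof -
        have "(\<Sum>k\<in>I. c k * Y k p) = U c (fst p) - q / s * U a (fst p) + q / s * snd p"
          by (simp add: Y_def \<zeta>_def U_def[of c] q_def algebra_simps sum.distrib sum_subtractf sum_distrib_left sum_divide_distrib)
        then show ?thesis unfolding Ud .
      qed
      have iUU: "integrable M (\<lambda>\<omega>. U c \<omega> * U a \<omega>)"
        by (intro integrable_mult_of_squares) simp_all
      have "M.expectation (\<lambda>\<omega>. (U d \<omega>)\<^sup>2) = M.expectation (\<lambda>\<omega>. (U c \<omega>)\<^sup>2 - 2 * (q / s) * (U c \<omega> * U a \<omega>) + (q / s)\<^sup>2 * (U a \<omega>)\<^sup>2)"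
        unfolding Ud by (simp add: power2_eq_square algebra_simps)
      also have "\<dots> = M.expectation (\<lambda>\<omega>. (U c \<omega>)\<^sup>2) - 2 * (q / s) * M.expectation (\<lambda>\<omega>. U c \<omega> * U a \<omega>) + (q / s)\<^sup>2 * M.expectation (\<lambda>\<omega>. (U a \<omega>)\<^sup>2)"
        using iUU by simp
      also have "\<dots> = M.expectation (\<lambda>\<omega>. (U c \<omega>)\<^sup>2) - q\<^sup>2 / s"
        unfolding UU s q_def[symmetric] using s0 by (simp add: power2_eq_square field_simps)
      finally have vard: "M.expectation (\<lambda>\<omega>. (U d \<omega>)\<^sup>2) = M.expectation (\<lambda>\<omega>. (U c \<omega>)\<^sup>2) - q\<^sup>2 / s" .
      have "(CLINT p|M \<Otimes>\<^sub>M n. iexp (\<Sum>k\<in>I. c k * Y k p)) = (CLINT p|M \<Otimes>\<^sub>M n. iexp (1 * U d (fst p)) * iexp (q / s * snd p))"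
        unfolding cY by (simp add: distrib_left exp_add)
      also have "\<dots> = (CLINT \<omega>|M. CLINT x|n. iexp (1 * U d \<omega>) * iexp (q / s * x))"
        by (subst P.integral_fst'[symmetric])
           (auto intro!: P.integrable_const_bound[of _ 1] AE_I2 simp: norm_mult simp del: of_real_mult of_real_divide)
      also have "\<dots> = (CLINT \<omega>|M. iexp (1 * U d \<omega>)) * (CLINT x|n. iexp (q / s * x))"
        by (simp only: integral_mult_right_zero integral_mult_left_zero)
      also have "\<dots> = exp (- M.expectation (\<lambda>\<omega>. (U d \<omega>)\<^sup>2) / 2) * exp (- (q / s)\<^sup>2 * s / 2)"
        unfolding M.gaussian_rv_char[OF gU U_mean] n.gaussian_rv_char[OF gn n_mean] n_var by simp
      also have "\<dots> = exp (- M.expectation (\<lambda>\<omega>. (U c \<omega>)\<^sup>2) / 2)"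
        unfolding vard of_real_mult[symmetric] mult_exp_exp using s0
        by (simp add: field_simps power2_eq_square)
      also have "\<dots> = (CLINT \<omega>|M. iexp (1 * U c \<omega>))"
        unfolding M.gaussian_rv_char[OF gU U_mean] by simp
      finally show ?thesis by (simp add: U_def)
    qed
    have law: "distr M (\<Pi>\<^sub>M k\<in>I. borel) (\<lambda>\<omega>. \<lambda>k\<in>I. \<xi> k \<omega>) = distr (M \<Otimes>\<^sub>M n) (\<Pi>\<^sub>M k\<in>I. borel) (\<lambda>p. \<lambda>k\<in>I. Y k p)"
      by (rule Levy_uniqueness_PiM[OF M P.prob_space_axioms I _ _ char]) measurable
    have transfer: "(\<integral>\<^sup>+\<omega>. g (\<lambda>k\<in>I. \<xi> k \<omega>) \<partial>M) = (\<integral>\<^sup>+p. g (\<lambda>k\<in>I. Y k p) \<partial>(M \<Otimes>\<^sub>M n))"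
      if [measurable]: "g \<in> borel_measurable (\<Pi>\<^sub>M k\<in>I. borel)" for g :: "('i \<Rightarrow> real) \<Rightarrow> ennreal"
    proof -
      have "(\<integral>\<^sup>+x. g x \<partial>distr M (\<Pi>\<^sub>M k\<in>I. borel) (\<lambda>\<omega>. \<lambda>k\<in>I. \<xi> k \<omega>)) = (\<integral>\<^sup>+\<omega>. g (\<lambda>k\<in>I. \<xi> k \<omega>) \<partial>M)"
        by (rule nn_integral_distr) measurable
      moreover have "(\<integral>\<^sup>+x. g x \<partial>distr (M \<Otimes>\<^sub>M n) (\<Pi>\<^sub>M k\<in>I. borel) (\<lambda>p. \<lambda>k\<in>I. Y k p)) = (\<integral>\<^sup>+p. g (\<lambda>k\<in>I. Y k p) \<partial>(M \<Otimes>\<^sub>M n))"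
        by (rule nn_integral_distr) measurable
      ultimately show ?thesis unfolding law by simp
    qed
    have n_int: "(\<integral>\<^sup>+x. g x \<partial>n) = (\<integral>\<^sup>+x. ennreal (normal_density 0 (sqrt s) x) * g x \<partial>lborel)"
      if "g \<in> borel_measurable borel" for g
      unfolding n_def using that by (subst nn_integral_density) auto
    \<comment> \<open>The inner restriction displays the integrand as a function of the restricted
      vector, the shape to which \<open>transfer\<close> applies.\<close>
    have "(\<integral>\<^sup>+\<omega>. f (\<lambda>k\<in>I. \<xi> k \<omega> + b k) \<partial>M) = (\<integral>\<^sup>+\<omega>. f (\<lambda>k\<in>I. (\<lambda>k\<in>I. \<xi> k \<omega>) k + b k) \<partial>M)"
      by (simp cong: restrict_cong)
    also have "\<dots> = (\<integral>\<^sup>+p. f (\<lambda>k\<in>I. (\<lambda>k\<in>I. Y k p) k + b k) \<partial>(M \<Otimes>\<^sub>M n))"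
      by (rule transfer) measurable
    also have "\<dots> = (\<integral>\<^sup>+p. f (\<lambda>k\<in>I. Y k p + b k) \<partial>(M \<Otimes>\<^sub>M n))"
      by (simp cong: restrict_cong)
    also have "\<dots> = (\<integral>\<^sup>+\<omega>. \<integral>\<^sup>+x. f (\<lambda>k\<in>I. Y k (\<omega>, x) + b k) \<partial>n \<partial>M)"
      by (rule n.nn_integral_fst[symmetric]) measurable
    also have "\<dots> = (\<integral>\<^sup>+\<omega>. \<integral>\<^sup>+x. ennreal (exp (x - s / 2)) * f (\<lambda>k\<in>I. Y k (\<omega>, x)) \<partial>n \<partial>M)"
    proof (rule nn_integral_cong)
      fix \<omega> assume [measurable]: "\<omega> \<in> space M"
      define G where "G x = f (\<lambda>k\<in>I. \<zeta> k \<omega> + b k / s * x)" for x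
      have G [measurable]: "G \<in> borel_measurable borel" unfolding G_def by measurable
      have "(\<integral>\<^sup>+x. f (\<lambda>k\<in>I. Y k (\<omega>, x) + b k) \<partial>n) = (\<integral>\<^sup>+x. G (s + 1 * x) \<partial>n)"
        unfolding G_def Y_def using s0 by (intro nn_integral_cong arg_cong[of _ _ f] restrict_ext) (simp add: field_simps)
      \<comment> \<open>The N(0, s) density at x is the N(s, s) density at s + x. Translation
        invariance of Lebesgue measure removes the shift, and tilting by exp (x - s / 2) leads back
        to N(0, s).\<close>
      also have "\<dots> = (\<integral>\<^sup>+x. ennreal (normal_density s (sqrt s) (s + 1 * x)) * G (s + 1 * x) \<partial>lborel)"
        by (subst n_int) (auto simp: normal_density_def)
      also have "\<dots> = (\<integral>\<^sup>+x. ennreal (normal_density s (sqrt s) x) * G x \<partial>lborel)"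
        using nn_integral_real_affine[of "\<lambda>x. ennreal (normal_density s (sqrt s) x) * G x" 1 s] by simp
      also have "\<dots> = (\<integral>\<^sup>+x. ennreal (normal_density 0 (sqrt s) x) * (ennreal (exp (x - s / 2)) * G x) \<partial>lborel)"
        using normal_density_tilt[OF s0, of _ 1] by (simp add: mult.assoc[symmetric] flip: ennreal_mult)
      also have "\<dots> = (\<integral>\<^sup>+x. ennreal (exp (x - s / 2)) * G x \<partial>n)"
        by (subst n_int) auto
      finally show "(\<integral>\<^sup>+x. f (\<lambda>k\<in>I. Y k (\<omega>, x) + b k) \<partial>n) = (\<integral>\<^sup>+x. ennreal (exp (x - s / 2)) * f (\<lambda>k\<in>I. Y k (\<omega>, x)) \<partial>n)"
        by (simp add: G_def Y_def)
    qed
    also have "\<dots> = (\<integral>\<^sup>+p. ennreal (exp (snd p - s / 2)) * f (\<lambda>k\<in>I. Y k p) \<partial>(M \<Otimes>\<^sub>M n))"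
      by (subst n.nn_integral_fst[symmetric]) simp_all
    finally have "(\<integral>\<^sup>+\<omega>. f (\<lambda>k\<in>I. \<xi> k \<omega> + b k) \<partial>M)\<^sup>2
        = (\<integral>\<^sup>+p. ennreal (exp (snd p - s / 2)) * f (\<lambda>k\<in>I. Y k p) \<partial>(M \<Otimes>\<^sub>M n))\<^sup>2" by simp
    also have "\<dots> \<le> (\<integral>\<^sup>+p. (ennreal (exp (snd p - s / 2)))\<^sup>2 \<partial>(M \<Otimes>\<^sub>M n)) * (\<integral>\<^sup>+p. (f (\<lambda>k\<in>I. Y k p))\<^sup>2 \<partial>(M \<Otimes>\<^sub>M n))"
      by (rule Cauchy_Schwarz_nn_integral) measurable
    also have "(\<integral>\<^sup>+p. (f (\<lambda>k\<in>I. Y k p))\<^sup>2 \<partial>(M \<Otimes>\<^sub>M n)) = (\<integral>\<^sup>+\<omega>. (f (\<lambda>k\<in>I. \<xi> k \<omega>))\<^sup>2 \<partial>M)"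
      by (rule transfer[symmetric]) measurable
    also have "(\<integral>\<^sup>+p. (ennreal (exp (snd p - s / 2)))\<^sup>2 \<partial>(M \<Otimes>\<^sub>M n)) = (\<integral>\<^sup>+\<omega>. \<integral>\<^sup>+x. (ennreal (exp (x - s / 2)))\<^sup>2 \<partial>n \<partial>M)"
      by (subst n.nn_integral_fst[symmetric]) simp_all
    also have "(\<integral>\<^sup>+x. (ennreal (exp (x - s / 2)))\<^sup>2 \<partial>n) = ennreal (exp s)"
    proof -
      have "(\<integral>\<^sup>+x. (ennreal (exp (x - s / 2)))\<^sup>2 \<partial>n)
          = (\<integral>\<^sup>+x. ennreal (normal_density 0 (sqrt s) x) * (ennreal (exp (x - s / 2)))\<^sup>2 \<partial>lborel)"
        by (subst n_int) auto
      also have "\<dots> = (\<integral>\<^sup>+x. ennreal (exp s) * ennreal (normal_density (2 * s) (sqrt s) x) \<partial>lborel)"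
      proof (rule nn_integral_cong)
        fix x
        \<comment> \<open>Splitting exp (2 x - s) in this way isolates the tilt with u = 2. What
          remains is the constant exp s times the density of N(2 s, s), whose integral is 1.\<close>
        have "(exp (x - s / 2))\<^sup>2 = exp s * exp (2 * x - 2\<^sup>2 * s / 2)"
          by (simp add: mult_exp_exp flip: exp_double)
        then have "normal_density 0 (sqrt s) x * (exp (x - s / 2))\<^sup>2 = exp s * normal_density (2 * s) (sqrt s) x"
          unfolding normal_density_tilt[OF s0, of x 2, symmetric] by simp
        then show "ennreal (normal_density 0 (sqrt s) x) * (ennreal (exp (x - s / 2)))\<^sup>2
            = ennreal (exp s) * ennreal (normal_density (2 * s) (sqrt s) x)"
          by (simp add: ennreal_power flip: ennreal_mult)
      qed
      also have "\<dots> = ennreal (exp s) * (\<integral>\<^sup>+x. ennreal (normal_density (2 * s) (sqrt s) x) \<partial>lborel)"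
        by (rule nn_integral_cmult) simp
      also have "(\<integral>\<^sup>+x. ennreal (normal_density (2 * s) (sqrt s) x) \<partial>lborel) = 1"
        using prob_space.emeasure_space_1[OF prob_space_normal_density[of "sqrt s" "2 * s"]] s0
        by (simp add: emeasure_density)
      finally show ?thesis by simp
    qed
    also have "(\<integral>\<^sup>+\<omega>. ennreal (exp s) \<partial>M) = ennreal (exp s)" by (simp add: M.emeasure_space_1)
    finally show ?thesis unfolding s_def .
  qed
qed

section \<open>Covariance matrices\<close>

text \<open>Translates linear systems with the covariance matrix into covariances of the components
  with a linear form, the shape required by \<open>gaussian_shift_bound\<close>.\<close>

lemma (in prob_space) covariance_mat_mult_vec:
  fixes \<xi> :: "nat \<Rightarrow> 'a \<Rightarrow> real"
  assumes meas: "\<And>k. k \<in> {1..n} \<Longrightarrow> \<xi> k \<in> borel_measurable M"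
    and sq: "\<And>k. k \<in> {1..n} \<Longrightarrow> integrable M (\<lambda>\<omega>. (\<xi> k \<omega>)\<^sup>2)"
    and mean: "\<And>k. k \<in> {1..n} \<Longrightarrow> expectation (\<xi> k) = 0"
    and i: "i < n"
  shows "(covariance_mat M n \<xi> *\<^sub>v vec n (\<lambda>j. c (Suc j))) $ i
    = expectation (\<lambda>\<omega>. \<xi> (Suc i) \<omega> * (\<Sum>k = 1..n. c k * \<xi> k \<omega>))"
proof -
  have I: "Suc j \<in> {1..n} \<longleftrightarrow> j < n" for j by auto
  have "expectation (\<lambda>\<omega>. \<xi> (Suc i) \<omega> * (\<Sum>k = 1..n. c k * \<xi> k \<omega>))
      = expectation (\<lambda>\<omega>. \<Sum>k = 1..n. (\<xi> (Suc i) \<omega> * \<xi> k \<omega>) * c k)"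
    by (simp add: sum_distrib_left mult_ac)
  also have "\<dots> = (\<Sum>k = 1..n. expectation (\<lambda>\<omega>. \<xi> (Suc i) \<omega> * \<xi> k \<omega>) * c k)"
    using i by (subst Bochner_Integration.integral_sum)
      (auto intro!: integrable_mult_left integrable_mult_of_squares meas sq)
  also have "\<dots> = (\<Sum>j = 0..<n. expectation (\<lambda>\<omega>. \<xi> (Suc i) \<omega> * \<xi> (Suc j) \<omega>) * c (Suc j))"
    by (simp add: sum.atLeast1_atMost_eq atLeast0LessThan)
  also have "\<dots> = (covariance_mat M n \<xi> *\<^sub>v vec n (\<lambda>j. c (Suc j))) $ i"
    using i mean[unfolded I]
    by (simp add: covariance_mat_def covariance_def scalar_prod_def mean)
  finally show ?thesis ..
qed

lemma invertible_mat_kernel: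
  fixes A :: "'a :: comm_ring_1 mat"
  assumes A: "A \<in> carrier_mat n n" "invertible_mat A" and v: "v \<in> carrier_vec n" and "A *\<^sub>v v = 0\<^sub>v n"
  shows "v = 0\<^sub>v n"
proof -
  obtain B where B: "inverts_mat B A" "inverts_mat A B" using A(2) unfolding invertible_mat_def by auto
  then have AB: "A * B = 1\<^sub>m n" "B * A = 1\<^sub>m (dim_row B)" using A unfolding inverts_mat_def by auto
  \<comment> \<open>\<open>invertible_mat\<close> leaves the dimensions of the inverse open; they
    are read off from the two product identities.\<close>
  have "dim_col B = n" using arg_cong[OF AB(1), of dim_col] by simp
  moreover have "dim_row B = n" using arg_cong[OF AB(2), of dim_col] A by simp
  ultimately have Bc: "B \<in> carrier_mat n n" by auto
  have "v = (B * A) *\<^sub>v v" using AB(2) Bc v by simp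
  also have "\<dots> = B *\<^sub>v (A *\<^sub>v v)" using A Bc v by simp
  also have "\<dots> = 0\<^sub>v n" unfolding assms(4) using Bc by auto
  finally show ?thesis .
qed

text \<open>A linear form that vanishes almost surely has zero covariance with every component, so
  its coefficients form a kernel vector of the covariance matrix.\<close>

lemma (in prob_space) covariance_nondegenerate:
  fixes \<xi> :: "nat \<Rightarrow> 'a \<Rightarrow> real"
  assumes meas: "\<And>k. k \<in> {1..n} \<Longrightarrow> \<xi> k \<in> borel_measurable M"
    and sq: "\<And>k. k \<in> {1..n} \<Longrightarrow> integrable M (\<lambda>\<omega>. (\<xi> k \<omega>)\<^sup>2)"
    and mean: "\<And>k. k \<in> {1..n} \<Longrightarrow> expectation (\<xi> k) = 0"
    and inv: "invertible_mat (covariance_mat M n \<xi>)"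
    and zero: "AE \<omega> in M. (\<Sum>k = 1..n. c k * \<xi> k \<omega>) = 0"
    and k: "k \<in> {1..n}"
  shows "c k = 0"
proof -
  have sum_meas: "(\<lambda>\<omega>. \<Sum>k = 1..n. c k * \<xi> k \<omega>) \<in> borel_measurable M"
    using meas by (intro borel_measurable_sum borel_measurable_times) auto
  have "covariance_mat M n \<xi> *\<^sub>v vec n (\<lambda>j. c (Suc j)) = 0\<^sub>v n"
  proof (rule eq_vecI)
    fix i assume "i < dim_vec (0\<^sub>v n :: real vec)"
    then have i: "i < n" by simp
    have "(\<lambda>\<omega>. \<xi> (Suc i) \<omega> * (\<Sum>k = 1..n. c k * \<xi> k \<omega>)) \<in> borel_measurable M"
      using i by (intro borel_measurable_times meas sum_meas) auto
    then have "expectation (\<lambda>\<omega>. \<xi> (Suc i) \<omega> * (\<Sum>k = 1..n. c k * \<xi> k \<omega>)) = expectation (\<lambda>\<omega>. 0)"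
      using zero i by (intro integral_cong_AE) auto
    then show "(covariance_mat M n \<xi> *\<^sub>v vec n (\<lambda>j. c (Suc j))) $ i = 0\<^sub>v n $ i"
      using covariance_mat_mult_vec[OF meas sq mean i, where c = c] i by simp
  qed (simp add: covariance_mat_def)
  then have "vec n (\<lambda>j. c (Suc j)) = 0\<^sub>v n"
    by (rule invertible_mat_kernel[rotated 3]) (rule inv | simp add: covariance_mat_def)+
  moreover have "k - 1 < n" using k by auto
  ultimately have "vec_index (vec n (\<lambda>j. c (Suc j))) (k - 1) = 0" by simp
  then show ?thesis using k \<open>k - 1 < n\<close> by simp
qed

text \<open>Padding by zeros makes linear forms in the first m components accessible to the
  hypotheses on all components.\<close>

lemma sum_extend_by_zero:
  fixes x :: "nat \<Rightarrow> real"
  assumes "m \<le> n"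
  shows "(\<Sum>k = 1..n. (if k \<le> m then c k else 0) * x k) = (\<Sum>k = 1..m. c k * x k)"
  using assms by (intro sum.mono_neutral_cong_right) auto

text \<open>A kernel vector of the leading block gives a linear form uncorrelated with each of its
  own summands, hence of variance zero. Padded by zeros, it contradicts the nondegeneracy of the
  full vector.\<close>

lemma (in prob_space) covariance_mat_leading_det:
  fixes \<xi> :: "nat \<Rightarrow> 'a \<Rightarrow> real"
  assumes meas: "\<And>k. k \<in> {1..n} \<Longrightarrow> \<xi> k \<in> borel_measurable M"
    and sq: "\<And>k. k \<in> {1..n} \<Longrightarrow> integrable M (\<lambda>\<omega>. (\<xi> k \<omega>)\<^sup>2)"
    and mean: "\<And>k. k \<in> {1..n} \<Longrightarrow> expectation (\<xi> k) = 0"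
    and inv: "invertible_mat (covariance_mat M n \<xi>)"
    and m: "m \<le> n"
  shows "det (covariance_mat M m \<xi>) \<noteq> 0"
proof
  have C: "covariance_mat M m \<xi> \<in> carrier_mat m m" by (simp add: covariance_mat_def)
  assume "det (covariance_mat M m \<xi>) = 0"
  then obtain w where w: "w \<in> carrier_vec m" "w \<noteq> 0\<^sub>v m" "covariance_mat M m \<xi> *\<^sub>v w = 0\<^sub>v m"
    using det_0_iff_vec_prod_zero_field[OF C] by auto
  define c where "c k = w $ (k - 1)" for k
  have wc: "w = vec m (\<lambda>j. c (Suc j))" using w(1) by (auto simp: c_def)
  define \<eta> where "\<eta> \<omega> = (\<Sum>k = 1..m. c k * \<xi> k \<omega>)" for \<omega>
  have in_n: "k \<in> {1..n}" if "k \<in> {1..m}" for k using that m by auto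
  have [measurable]: "\<eta> \<in> borel_measurable M"
    unfolding \<eta>_def using meas in_n by (intro borel_measurable_sum borel_measurable_times) auto
  have orth: "expectation (\<lambda>\<omega>. \<xi> k \<omega> * \<eta> \<omega>) = 0" if "k \<in> {1..m}" for k
    using covariance_mat_mult_vec[where n = m and \<xi> = \<xi> and i = "k - 1" and c = c] w(3) that meas sq mean in_n
    unfolding wc \<eta>_def by auto
  have int: "integrable M (\<lambda>\<omega>. \<xi> k \<omega> * \<eta> \<omega>)" if "k \<in> {1..m}" for k
    unfolding \<eta>_def sum_distrib_left mult.left_commute[of _ "c _"]
    using that meas sq in_n
    by (intro Bochner_Integration.integrable_sum integrable_mult_right integrable_mult_of_squares) auto
  have sq_eq: "(\<eta> \<omega>)\<^sup>2 = (\<Sum>k = 1..m. c k * (\<xi> k \<omega> * \<eta> \<omega>))" for \<omega>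
    by (simp add: power2_eq_square \<eta>_def sum_distrib_right mult.assoc)
  have "expectation (\<lambda>\<omega>. (\<eta> \<omega>)\<^sup>2) = 0"
    unfolding sq_eq by (subst Bochner_Integration.integral_sum) (auto simp: orth int)
  moreover have "integrable M (\<lambda>\<omega>. (\<eta> \<omega>)\<^sup>2)"
    unfolding sq_eq by (auto intro!: integrable_mult_right int)
  ultimately have "AE \<omega> in M. (\<eta> \<omega>)\<^sup>2 = 0"
    by (subst integral_nonneg_eq_0_iff_AE[symmetric]) simp_all
  then have "AE \<omega> in M. (\<Sum>k = 1..n. (if k \<le> m then c k else 0) * \<xi> k \<omega>) = 0"
    unfolding sum_extend_by_zero[OF m] by (simp add: \<eta>_def)
  then have "(if k \<le> m then c k else 0) = 0" if "k \<in> {1..n}" for k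
    by (intro covariance_nondegenerate[OF meas sq mean inv _ that]) auto
  then have "c k = 0" if "k \<in> {1..m}" for k
    using in_n[OF that] that by (metis atLeastAtMost_iff)
  then have "w = 0\<^sub>v m" unfolding wc by auto
  with w(2) show False ..
qed

text \<open>A nonzero determinant excludes the value \<open>None\<close> of
  \<open>mat_inverse\<close>, so that \<open>the\<close> in the modeling bias yields a genuine
  inverse.\<close>

lemma mat_inverse_solves:
  fixes A :: "real mat"
  assumes A: "A \<in> carrier_mat n n" and "det A \<noteq> 0" and b: "b \<in> carrier_vec n"
  shows "the (mat_inverse A) *\<^sub>v b \<in> carrier_vec n" "A *\<^sub>v (the (mat_inverse A) *\<^sub>v b) = b"
proof -
  have "A \<in> Units (ring_mat TYPE(real) n ())"
    using det_non_zero_imp_unit[OF A] assms(2) .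
  then obtain D where D: "mat_inverse A = Some D"
    using mat_inverse(1)[OF A, of "()"] by (cases "mat_inverse A") auto
  from mat_inverse(2)[OF A this] have AD: "A * D = 1\<^sub>m n" and Dc: "D \<in> carrier_mat n n" by auto
  then show "the (mat_inverse A) *\<^sub>v b \<in> carrier_vec n" using D b by simp
  have "A *\<^sub>v (D *\<^sub>v b) = (A * D) *\<^sub>v b" using A Dc b by simp
  then show "A *\<^sub>v (the (mat_inverse A) *\<^sub>v b) = b" using AD b D by simp
qed

section \<open>The selection procedure\<close>

text \<open>Index 1 passes all tests vacuously, so the maximum is taken over a nonempty finite set
  and is attained.\<close>

lemma selected_props:
  assumes "1 \<le> K"
  shows "selected K v z x \<in> {1..K}"
    and "\<And>l m. 1 \<le> l \<Longrightarrow> l < m \<Longrightarrow> m \<le> selected K v z x \<Longrightarrow> ennreal (test_stat v x l m) \<le> z l"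
    and "\<And>k. k \<in> {1..K} \<Longrightarrow> (\<And>l m. 1 \<le> l \<Longrightarrow> l < m \<Longrightarrow> m \<le> k \<Longrightarrow> ennreal (test_stat v x l m) \<le> z l) \<Longrightarrow> k \<le> selected K v z x"
proof -
  let ?S = "{k \<in> {1..K}. \<forall>l m. 1 \<le> l \<and> l < m \<and> m \<le> k \<longrightarrow> ennreal (test_stat v x l m) \<le> z l}"
  have fin: "finite ?S" by simp
  have "1 \<in> ?S" using assms by auto
  then have "selected K v z x \<in> ?S"
    unfolding selected_def by (intro Max_in fin) blast
  then show "selected K v z x \<in> {1..K}"
    and "\<And>l m. 1 \<le> l \<Longrightarrow> l < m \<Longrightarrow> m \<le> selected K v z x \<Longrightarrow> ennreal (test_stat v x l m) \<le> z l"
    by blast+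
  show "k \<le> selected K v z x" if "k \<in> {1..K}"
      "\<And>l m. 1 \<le> l \<Longrightarrow> l < m \<Longrightarrow> m \<le> k \<Longrightarrow> ennreal (test_stat v x l m) \<le> z l" for k
    unfolding selected_def using that by (intro Max_ge fin) blast
qed

text \<open>Whether k is accepted depends only on tests among the first k indices, and acceptance
  passes to smaller indices. Truncation at m therefore amounts to running the procedure on m
  estimates, which makes the stepwise error a function of the first m coordinates.\<close>

lemma min_selected:
  assumes "1 \<le> m" "m \<le> K"
  shows "min (selected K v z x) m = selected m v z x"
proof (rule antisym)
  have K: "1 \<le> K" using assms by simp
  note sK = selected_props[OF K, where v = v and z = z and x = x]
    and sm = selected_props[OF assms(1), where v = v and z = z and x = x]
  show "min (selected K v z x) m \<le> selected m v z x"
    using sK(1) assms by (intro sm(3) sK(2)) auto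
  have "selected m v z x \<le> selected K v z x"
    using sm(1) assms by (intro sK(3) sm(2)) auto
  then show "selected m v z x \<le> min (selected K v z x) m" using sm(1) by simp
qed

text \<open>The tests see only differences. This allows both subtracting the target from all
  estimates and restricting to the first m coordinates.\<close>

lemma selected_cong:
  assumes "\<And>l k. l \<in> {1..m} \<Longrightarrow> k \<in> {1..m} \<Longrightarrow> x l - x k = y l - y k"
  shows "selected m v z x = selected m v z y"
proof -
  have "(\<forall>l j. 1 \<le> l \<and> l < j \<and> j \<le> k \<longrightarrow> ennreal (test_stat v x l j) \<le> z l)
      \<longleftrightarrow> (\<forall>l j. 1 \<le> l \<and> l < j \<and> j \<le> k \<longrightarrow> ennreal (test_stat v y l j) \<le> z l)" if "k \<in> {1..m}" for k
  proof -
    have "test_stat v x l j = test_stat v y l j" if "1 \<le> l \<and> l < j \<and> j \<le> k" for l j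
      unfolding test_stat_def using that \<open>k \<in> {1..m}\<close> by (subst assms) auto
    then show ?thesis by auto
  qed
  then have "{k \<in> {1..m}. \<forall>l j. 1 \<le> l \<and> l < j \<and> j \<le> k \<longrightarrow> ennreal (test_stat v x l j) \<le> z l}
      = {k \<in> {1..m}. \<forall>l j. 1 \<le> l \<and> l < j \<and> j \<le> k \<longrightarrow> ennreal (test_stat v y l j) \<le> z l}"
    by blast
  then show ?thesis unfolding selected_def by simp
qed

lemma selected_measurable [measurable]:
  "selected m v z \<in> measurable (\<Pi>\<^sub>M k\<in>{1..m}. borel) (count_space UNIV)"
proof -
  \<comment> \<open>With all quantifiers bounded by the finite index set, the condition is a finite
    combination of measurable ones.\<close>
  have eq: "selected m v z = (\<lambda>x. Max {k. k \<in> {1..m} \<and>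
      (\<forall>l\<in>{1..m}. \<forall>j\<in>{1..m}. l < j \<and> j \<le> k \<longrightarrow> ennreal (inverse (v l) * (x l - x j)\<^sup>2 / 2) \<le> z l)})"
    unfolding selected_def test_stat_def by (intro ext arg_cong[of _ _ Max]) auto
  show ?thesis unfolding eq by measurable
qed

lemma component_selected_measurable:
  assumes "1 \<le> m"
  shows "(\<lambda>x. x (selected m v z x)) \<in> borel_measurable (\<Pi>\<^sub>M k\<in>{1..m}. borel :: real measure)"
proof -
  \<comment> \<open>Summing over the possible values of the selected index removes the random
    index.\<close>
  have eq: "x (selected m v z x) = (\<Sum>k\<in>{1..m}. if selected m v z x = k then x k else 0)" for x :: "nat \<Rightarrow> real"
    using selected_props(1)[OF assms, of v z x] by (simp add: sum.delta')
  show ?thesis unfolding eq by measurable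
qed

lemma ennreal_le_of_power2_le:
  assumes "A\<^sup>2 \<le> ennreal (c\<^sup>2)" "0 \<le> c"
  shows "A \<le> ennreal c"
proof (cases A)
  case (real r)
  then show ?thesis using assms power2_le_imp_le[of r c] by (simp add: ennreal_power ennreal_le_iff)
next
  case top
  then show ?thesis using assms by (simp add: power2_eq_square top_unique)
qed

text \<open>Here \<open>y\<close> stands for the estimates minus the target. If the selected index p
  exceeds m, the first term on the right is zero, and p can only have been selected because the test
  of m against p was accepted; this bounds the distance of \<open>y p\<close> from
  \<open>y m\<close>.\<close>

lemma adaptive_error_decomposition:
  fixes y :: "nat \<Rightarrow> real"
  assumes m: "1 \<le> m" "m \<le> K" and v: "0 < v m" and z: "z m = ennreal c" "0 \<le> c"
  shows "\<bar>y (selected K v z y)\<bar> \<le> \<bar>y (selected m v z y) - y m\<bar> + \<bar>y m\<bar> + sqrt (2 * c * v m)"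
proof -
  have K: "1 \<le> K" using m by simp
  define p where "p = selected K v z y"
  have q: "selected m v z y = min p m" unfolding p_def by (rule min_selected[OF m, symmetric])
  show ?thesis
  proof (cases "p \<le> m")
    case True
    have "0 \<le> sqrt (2 * c * v m)" using v z by simp
    then show ?thesis
      using abs_triangle_ineq[of "y p - y m" "y m"]
      unfolding q p_def[symmetric] min_absorb1[OF True] by linarith
  next
    case False
    then have "ennreal (test_stat v y m p) \<le> z m"
      using selected_props(2)[OF K, where v = v and z = z and x = y and l = m and m = p] m by (simp add: p_def)
    then have "(y m - y p)\<^sup>2 \<le> 2 * c * v m"
      using z v by (simp add: test_stat_def ennreal_le_iff field_simps)
    then have "\<bar>y m - y p\<bar> \<le> sqrt (2 * c * v m)"
      using real_le_rsqrt by (metis power2_abs)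
    then show ?thesis using False unfolding q p_def[symmetric] by (simp add: min_def)
  qed
qed

lemma abs_normal_moment_1: "abs_normal_moment 1 = 1"
proof -
  have "\<bar>x\<bar> powr (2 * 1) = x\<^sup>2" for x :: real
    using powr_realpow'[of "\<bar>x\<bar>" 2] by (cases "x = 0") (simp_all add: powr_realpow)
  then show ?thesis
    unfolding abs_normal_moment_def using integral_std_normal_moment_even[of 1] by simp
qed

section \<open>Risk of the adaptive estimate at the largest index with small modeling bias\<close>

theorem corollary3p7:
  fixes M :: "'a measure"
    and K kstar :: nat
    and \<theta> v :: "nat \<Rightarrow> real"
    and \<xi> X :: "nat \<Rightarrow> 'a \<Rightarrow> real"
    and B :: "real mat"
    and z :: "nat \<Rightarrow> ennreal"
    and t \<alpha> \<Delta> :: real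
  assumes "prob_space M"
    and "1 \<le> K"
    and "gaussian_vector M K \<xi>"
    and "\<And>k. k \<in> {1..K} \<Longrightarrow> prob_space.expectation M (\<xi> k) = 0"
    and "covariance_mat M K \<xi> = B"
    and "invertible_mat B"
    and "\<And>k \<omega>. X k \<omega> = \<theta> k + \<xi> k \<omega>"
    and "\<And>k. k \<in> {1..K} \<Longrightarrow> v k = prob_space.variance M (X k)"
    and "\<And>k. 1 \<le> k \<Longrightarrow> k < K \<Longrightarrow> v (Suc k) \<le> v k"
    and "z K < \<infinity>"
    and "0 < \<alpha>" and "\<alpha> \<le> 1"
    and "0 < \<Delta>"
    and "modeling_bias M X \<theta> t 1 \<le> \<Delta>"
    and "kstar = Max {k \<in> {1..K}. modeling_bias M X \<theta> t k \<le> \<Delta>}"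
    and propagation: "\<And>k. k \<in> {2..K} \<Longrightarrow>
      (\<integral>\<^sup>+\<omega>. ennreal \<bar>inverse (v k) * (stepwise_estimate K v z k (\<lambda>j. \<xi> j \<omega>) - \<xi> k \<omega>)\<^sup>2\<bar> \<partial>M)
        \<le> ennreal (\<alpha> * abs_normal_moment 1)"
  shows "ennreal (v kstar powr (- 1 / 2)) *
      (\<integral>\<^sup>+\<omega>. ennreal \<bar>adaptive_estimate K v z (\<lambda>j. X j \<omega>) - t\<bar> \<partial>M)
        \<le> ennreal (2 * sqrt (exp \<Delta>)) + ennreal_sqrt (2 * z kstar)"
proof -
  interpret prob_space M by fact
  note mean = assms(4) and X = assms(7) and v_var = assms(8)
  have inv: "invertible_mat (covariance_mat M K \<xi>)" using assms(5,6) by simp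
  have gauss: "gaussian_rv M (\<lambda>\<omega>. \<Sum>k = 1..K. c k * \<xi> k \<omega>)" for c
    using assms(3) unfolding gaussian_vector_def by blast
  have \<xi>_sum: "(\<Sum>j = 1..K. (if j = k then 1 else 0) * \<xi> j \<omega>) = \<xi> k \<omega>" if "k \<in> {1..K}" for k \<omega>
    using that by (simp add: if_distrib[of "\<lambda>x. x * _"] cong: if_cong)
  have gauss_\<xi>: "gaussian_rv M (\<xi> k)" if "k \<in> {1..K}" for k
    using gauss[of "\<lambda>j. if j = k then 1 else 0"] unfolding \<xi>_sum[OF that] .
  note meas = gaussian_rv_measurable[OF gauss_\<xi>] and int = gaussian_rv_integrable1[OF gauss_\<xi>]
    and sq = gaussian_rv_integrable2[OF gauss_\<xi>]
  have X_mean: "expectation (X k) = \<theta> k" if "k \<in> {1..K}" for k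
    using that mean int by (simp add: X[abs_def] prob_space)
  have v: "v k = expectation (\<lambda>\<omega>. (\<xi> k \<omega>)\<^sup>2)" if "k \<in> {1..K}" for k
    unfolding v_var[OF that] X_mean[OF that] by (simp add: X)
  \<comment> \<open>Zero variance would make the linear form with the single coefficient 1 at k
    vanish almost surely, against the invertibility of \<open>B\<close>.\<close>
  have v_pos: "0 < v k" if k: "k \<in> {1..K}" for k
  proof (rule ccontr)
    assume "\<not> 0 < v k"
    moreover have "0 \<le> expectation (\<lambda>\<omega>. (\<xi> k \<omega>)\<^sup>2)" by simp
    ultimately have "expectation (\<lambda>\<omega>. (\<xi> k \<omega>)\<^sup>2) = 0" using v[OF k] by linarith
    then have "AE \<omega> in M. (\<xi> k \<omega>)\<^sup>2 = 0"
      using sq[OF k] by (subst integral_nonneg_eq_0_iff_AE[symmetric]) simp_all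
    then have "AE \<omega> in M. (\<Sum>j = 1..K. (if j = k then 1 else 0) * \<xi> j \<omega>) = 0"
      unfolding \<xi>_sum[OF k] by simp
    from covariance_nondegenerate[OF meas sq mean inv this k] show False by simp
  qed

  define m where "m = kstar"
  \<comment> \<open>Index 1 has small bias by assumption, so the set is nonempty and contains its
    maximum.\<close>
  have "m \<in> {k \<in> {1..K}. modeling_bias M X \<theta> t k \<le> \<Delta>}"
    unfolding m_def assms(15) using assms(2,14) by (intro Max_in) auto
  then have m: "m \<in> {1..K}" "1 \<le> m" "m \<le> K" and bias: "modeling_bias M X \<theta> t m \<le> \<Delta>" by auto
  have in_K: "k \<in> {1..K}" if "k \<in> {1..m}" for k using that m by auto
  note vm = v_pos[OF m(1)]
  define b where "b k = \<theta> k - t" for k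
  define C where "C = covariance_mat M m \<xi>"
  have C: "C \<in> carrier_mat m m" by (simp add: C_def covariance_mat_def)
  \<comment> \<open>Centering removes the deterministic means, so estimates and noise share their
    covariance matrix.\<close>
  have CX: "covariance_mat M m X = C"
    unfolding C_def covariance_mat_def covariance_def
    by (rule cong_mat) (use m in \<open>auto simp: X_mean mean X\<close>)
  have detC: "det C \<noteq> 0"
    unfolding C_def by (rule covariance_mat_leading_det[OF meas sq mean inv m(3)])
  \<comment> \<open>The entries of w are the coefficients of the linear form whose covariances with
    the components are the biases. The exponent in the shift bound then becomes exactly the modeling
    bias at m.\<close>
  define w where "w = the (mat_inverse C) *\<^sub>v bias_vec \<theta> t m"
  have w: "w \<in> carrier_vec m" "C *\<^sub>v w = bias_vec \<theta> t m"
    unfolding w_def using mat_inverse_solves[OF C detC] by (simp_all add: bias_vec_def)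
  define a where "a k = w $ (k - 1)" for k
  have wa: "w = vec m (\<lambda>j. a (Suc j))" using w(1) by (auto simp: a_def)
  have "modeling_bias M X \<theta> t m = scalar_prod (bias_vec \<theta> t m) w"
    unfolding modeling_bias_def CX w_def ..
  also have "\<dots> = (\<Sum>k = 1..m. a k * b k)"
    unfolding wa by (simp add: scalar_prod_def bias_vec_def b_def sum.atLeast1_atMost_eq atLeast0LessThan mult.commute)
  finally have ab: "(\<Sum>k\<in>{1..m}. a k * b k) \<le> \<Delta>" using bias by simp
  have shift: "expectation (\<lambda>\<omega>. \<xi> k \<omega> * (\<Sum>j\<in>{1..m}. a j * \<xi> j \<omega>)) = b k" if k: "k \<in> {1..m}" for k
  proof -
    obtain i where i: "k = Suc i" "i < m" using k by (cases k) auto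
    have "(covariance_mat M m \<xi> *\<^sub>v vec m (\<lambda>j. a (Suc j))) $ i
        = expectation (\<lambda>\<omega>. \<xi> (Suc i) \<omega> * (\<Sum>j = 1..m. a j * \<xi> j \<omega>))"
      using i by (intro covariance_mat_mult_vec meas sq mean in_K) auto
    then show ?thesis using w(2) i by (simp add: C_def[symmetric] wa[symmetric] bias_vec_def b_def)
  qed
  have gauss_m: "gaussian_rv M (\<lambda>\<omega>. \<Sum>k\<in>{1..m}. c k * \<xi> k \<omega>)" for c
    using gauss[of "\<lambda>k. if k \<le> m then c k else 0"] unfolding sum_extend_by_zero[OF m(3)] .

  define y where "y \<omega> = (\<lambda>k\<in>{1..m}. \<xi> k \<omega> + b k)" for \<omega>
  \<comment> \<open>Common to the stepwise error and the error of the estimate m: if the second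
    moment without bias is at most v m, adding the bias costs only a factor sqrt (exp \<Delta>) in
    the bound on the first absolute moment.\<close>
  have error_bound: "(\<integral>\<^sup>+\<omega>. ennreal \<bar>f (y \<omega>)\<bar> \<partial>M) \<le> ennreal (sqrt (exp \<Delta>) * sqrt (v m))"
    if [measurable]: "f \<in> borel_measurable (\<Pi>\<^sub>M k\<in>{1..m}. borel)"
      and f: "(\<integral>\<^sup>+\<omega>. ennreal ((f (\<lambda>k\<in>{1..m}. \<xi> k \<omega>))\<^sup>2) \<partial>M) \<le> ennreal (v m)" for f :: "(nat \<Rightarrow> real) \<Rightarrow> real"
  proof (rule ennreal_le_of_power2_le)
    have "(\<integral>\<^sup>+\<omega>. ennreal \<bar>f (y \<omega>)\<bar> \<partial>M)\<^sup>2
        \<le> ennreal (exp (\<Sum>k\<in>{1..m}. a k * b k)) * (\<integral>\<^sup>+\<omega>. (ennreal \<bar>f (\<lambda>k\<in>{1..m}. \<xi> k \<omega>)\<bar>)\<^sup>2 \<partial>M)"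
      unfolding y_def
      by (rule gaussian_shift_bound[OF prob_space_axioms finite_atLeastAtMost gauss_m mean[OF in_K] shift]) measurable
    also have "\<dots> \<le> ennreal (exp \<Delta>) * ennreal (v m)"
      using f ab by (intro mult_mono) (auto simp: ennreal_power ennreal_leI)
    also have "\<dots> = ennreal ((sqrt (exp \<Delta>) * sqrt (v m))\<^sup>2)"
      using vm by (simp add: power_mult_distrib ennreal_mult)
    finally show "(\<integral>\<^sup>+\<omega>. ennreal \<bar>f (y \<omega>)\<bar> \<partial>M)\<^sup>2 \<le> ennreal ((sqrt (exp \<Delta>) * sqrt (v m))\<^sup>2)" .
  qed (use vm in simp)

  note comp_meas [measurable] = component_selected_measurable[OF m(2), of v z]
  have last_meas [measurable]: "(\<lambda>x. x m) \<in> borel_measurable (\<Pi>\<^sub>M k\<in>{1..m}. borel :: real measure)"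
    using m(2) by (intro measurable_component_singleton) simp
  have restrict_sel: "selected m v z (restrict x {1..m}) = selected m v z x" for x :: "nat \<Rightarrow> real"
    by (rule selected_cong) simp
  have sel_m: "selected m v z x \<in> {1..m}" for x
    by (rule selected_props(1)[OF m(2)])
  have y_meas: "(\<lambda>\<omega>. y \<omega>) \<in> measurable M (\<Pi>\<^sub>M k\<in>{1..m}. borel)"
    unfolding y_def using meas in_K by (intro measurable_restrict borel_measurable_add) auto
  have \<xi>_meas: "(\<lambda>\<omega>. \<lambda>k\<in>{1..m}. \<xi> k \<omega>) \<in> measurable M (\<Pi>\<^sub>M k\<in>{1..m}. borel)"
    using meas in_K by (intro measurable_restrict) auto

  have E1: "(\<integral>\<^sup>+\<omega>. ennreal \<bar>y \<omega> (selected m v z (y \<omega>)) - y \<omega> m\<bar> \<partial>M) \<le> ennreal (sqrt (exp \<Delta>) * sqrt (v m))"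
  proof (rule error_bound)
    let ?D = "\<lambda>\<omega>. \<xi> (selected m v z (\<lambda>k. \<xi> k \<omega>)) \<omega> - \<xi> m \<omega>"
    have D: "(\<lambda>k\<in>{1..m}. \<xi> k \<omega>) (selected m v z (\<lambda>k\<in>{1..m}. \<xi> k \<omega>)) - (\<lambda>k\<in>{1..m}. \<xi> k \<omega>) m = ?D \<omega>" for \<omega>
      unfolding restrict_sel using sel_m[of "\<lambda>k. \<xi> k \<omega>"] m(2) by simp
    have D_meas [measurable]: "?D \<in> borel_measurable M"
      unfolding D[symmetric] using \<xi>_meas by measurable
    show "(\<integral>\<^sup>+\<omega>. ennreal (((\<lambda>k\<in>{1..m}. \<xi> k \<omega>) (selected m v z (\<lambda>k\<in>{1..m}. \<xi> k \<omega>)) - (\<lambda>k\<in>{1..m}. \<xi> k \<omega>) m)\<^sup>2) \<partial>M) \<le> ennreal (v m)"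
      unfolding D
    proof (cases "m = 1")
      case True
      \<comment> \<open>The propagation condition starts at k = 2. For m = 1 the procedure on a
        single estimate must select it, and the stepwise error is zero.\<close>
      then have "selected m v z x = m" for x using sel_m[of x] by simp
      then show "(\<integral>\<^sup>+\<omega>. ennreal ((?D \<omega>)\<^sup>2) \<partial>M) \<le> ennreal (v m)" by simp
    next
      case False
      with m have m2: "m \<in> {2..K}" by auto
      \<comment> \<open>Factoring out v m leaves the normalised loss of the propagation condition at
        k = m. Its bound is at most 1, because the normal moment is 1 and \<alpha> is at most
        1.\<close>
      have "(\<integral>\<^sup>+\<omega>. ennreal ((?D \<omega>)\<^sup>2) \<partial>M) = (\<integral>\<^sup>+\<omega>. ennreal (v m) * ennreal \<bar>inverse (v m) * (?D \<omega>)\<^sup>2\<bar> \<partial>M)"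
        using vm by (intro nn_integral_cong) (simp add: abs_mult flip: ennreal_mult)
      also have "\<dots> = ennreal (v m) * (\<integral>\<^sup>+\<omega>. ennreal \<bar>inverse (v m) * (?D \<omega>)\<^sup>2\<bar> \<partial>M)"
        by (rule nn_integral_cmult) measurable
      also have "\<dots> \<le> ennreal (v m) * ennreal (\<alpha> * abs_normal_moment 1)"
        using propagation[OF m2] unfolding stepwise_estimate_def min_selected[OF m(2,3)]
        by (rule mult_left_mono) simp
      also have "\<dots> \<le> ennreal (v m) * 1"
        using assms(12) by (intro mult_left_mono) (simp_all add: abs_normal_moment_1)
      finally show "(\<integral>\<^sup>+\<omega>. ennreal ((?D \<omega>)\<^sup>2) \<partial>M) \<le> ennreal (v m)" by simp
    qed
  qed measurable
  have E2: "(\<integral>\<^sup>+\<omega>. ennreal \<bar>y \<omega> m\<bar> \<partial>M) \<le> ennreal (sqrt (exp \<Delta>) * sqrt (v m))"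
  proof (rule error_bound)
    show "(\<integral>\<^sup>+\<omega>. ennreal (((\<lambda>k\<in>{1..m}. \<xi> k \<omega>) m)\<^sup>2) \<partial>M) \<le> ennreal (v m)"
      using m sq[OF m(1)] by (simp add: v[OF m(1)] nn_integral_eq_integral)
  qed measurable

  show ?thesis
  proof (cases "z m = \<infinity>")
    case True
    then show ?thesis by (simp add: m_def ennreal_sqrt_def ennreal_mult_top)
  next
    case False
    then obtain c where c: "z m = ennreal c" "0 \<le> c" by (cases "z m") auto
    have pointwise: "\<bar>adaptive_estimate K v z (\<lambda>j. X j \<omega>) - t\<bar>
        \<le> \<bar>y \<omega> (selected m v z (y \<omega>)) - y \<omega> m\<bar> + \<bar>y \<omega> m\<bar> + sqrt (2 * c * v m)" for \<omega>
    proof -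
      let ?y = "\<lambda>k. \<xi> k \<omega> + b k"
      \<comment> \<open>The target t cancels in every test statistic, so the procedure selects the
        same index from \<open>X\<close> as from the noise plus bias.\<close>
      have Xy: "X j \<omega> = t + ?y j" for j by (simp add: X b_def)
      have "selected K v z (\<lambda>j. X j \<omega>) = selected K v z ?y"
        by (rule selected_cong) (simp add: Xy)
      then have "adaptive_estimate K v z (\<lambda>j. X j \<omega>) - t = ?y (selected K v z ?y)"
        unfolding adaptive_estimate_def by (simp add: Xy)
      also have "\<bar>\<dots>\<bar> \<le> \<bar>?y (selected m v z ?y) - ?y m\<bar> + \<bar>?y m\<bar> + sqrt (2 * c * v m)"
        using m(2,3) vm c by (rule adaptive_error_decomposition[where v = v and z = z])
      also have "?y (selected m v z ?y) = y \<omega> (selected m v z (y \<omega>))"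
        unfolding y_def restrict_sel using sel_m[of ?y] by simp
      also have "?y m = y \<omega> m" using m(2) by (simp add: y_def)
      finally show ?thesis .
    qed
    have root: "v m powr (- 1 / 2) = 1 / sqrt (v m)"
      using vm powr_minus[of "v m" "1 / 2"] by (simp add: powr_half_sqrt inverse_eq_divide)
    have "(\<integral>\<^sup>+\<omega>. ennreal \<bar>adaptive_estimate K v z (\<lambda>j. X j \<omega>) - t\<bar> \<partial>M)
        \<le> (\<integral>\<^sup>+\<omega>. ennreal \<bar>y \<omega> (selected m v z (y \<omega>)) - y \<omega> m\<bar> + ennreal \<bar>y \<omega> m\<bar> + ennreal (sqrt (2 * c * v m)) \<partial>M)"
      using pointwise vm c(2) by (intro nn_integral_mono) (simp add: ennreal_leI flip: ennreal_plus)
    also have "\<dots> = (\<integral>\<^sup>+\<omega>. ennreal \<bar>y \<omega> (selected m v z (y \<omega>)) - y \<omega> m\<bar> \<partial>M) + (\<integral>\<^sup>+\<omega>. ennreal \<bar>y \<omega> m\<bar> \<partial>M) + ennreal (sqrt (2 * c * v m))"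
      using measurable_compose[OF y_meas comp_meas] measurable_compose[OF y_meas last_meas]
      by (simp add: nn_integral_add emeasure_space_1)
    also have "\<dots> \<le> ennreal (sqrt (exp \<Delta>) * sqrt (v m)) + ennreal (sqrt (exp \<Delta>) * sqrt (v m)) + ennreal (sqrt (2 * c * v m))"
      by (intro add_mono E1 E2 order_refl)
    also have "\<dots> = ennreal (sqrt (v m) * (2 * sqrt (exp \<Delta>) + sqrt (2 * c)))"
      using vm c(2) by (simp add: real_sqrt_mult algebra_simps flip: ennreal_plus)
    finally have "ennreal (v m powr (- 1 / 2)) * (\<integral>\<^sup>+\<omega>. ennreal \<bar>adaptive_estimate K v z (\<lambda>j. X j \<omega>) - t\<bar> \<partial>M)
        \<le> ennreal (1 / sqrt (v m)) * ennreal (sqrt (v m) * (2 * sqrt (exp \<Delta>) + sqrt (2 * c)))"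
      unfolding root by (rule mult_left_mono) simp
    also have "\<dots> = ennreal (2 * sqrt (exp \<Delta>) + sqrt (2 * c))"
      using vm c(2) by (simp flip: ennreal_mult)
    also have "\<dots> = ennreal (2 * sqrt (exp \<Delta>)) + ennreal_sqrt (2 * z m)"
    proof -
      have "2 * z m = ennreal (2 * c)" using c by (simp add: ennreal_mult)
      then show ?thesis using c(2) by (simp add: ennreal_sqrt_def ennreal_plus)
    qed
    finally show ?thesis unfolding m_def .
  qed
qed

end
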